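(* Let $a>0$, let $\alpha$ be a unitary $2\times2$ matrix, and let $B$ be the Livšic characteristic function of $L_2=-\frac{d^2}{dx^2}$ on $L^2(-a,a)$. The spectral measure $\mu^{B\alpha^*}$ of the operator $L_{2,\alpha}$ has point spectrum at $s\in\mathbb{R}$ (i.e. $\mu^{B\alpha^*}(\{s\})\neq0$) if the matrix $I-B(w)\alpha^*$ has nontrivial kernel in the limit as $w\in\mathbb{C}^+$ approaches $s$ non-tangentially (i.e. the limit matrix has nontrivial kernel).
   Context: $L_{2,\max}f=-f''$ on $\{f\in L^2(-a,a): f,f'\in AC_{loc}(-a,a),\ f''\in L^2(-a,a)\}$, and $L_{2,\min}=L_{2,\max}^*$ has deficiency indices $(2,2)$; its self-adjoint extensions $L_{2,\alpha}$ are parametrized by unitary $2\times 2$ matrices $\alpha$. Livšic characteristic function: for $w\in\mathbb{C}^+$ (the open upper half-plane), let $\phi_{2,k}(w;x)=e^{(-1)^k i\sqrt w\,x}$, $k=1,2$ (principal root), which form a basis of $\ker(L_{2,\max}-wI)$; for $z=\pm i$ let $\{\tilde\phi_{2,1}(z;\cdot),\tilde\phi_{2,2}(z;\cdot)\}$ be an orthonormal basis of $\ker(L_{2,\max}-zI)$, obtained as linear combinations of $e^{i\sqrt{z}x}$ and $e^{-i\sqrt{z}x}$. Set $$A(w,z)_{j,\ell}=\langle\phi_{2,j}(w;\cdot),\tilde\phi_{2,\ell}(z;\cdot)\rangle_{L^2(-a,a)},\qquad B(w)=\frac{w-i}{w+i}\,A(w,i)^{-1}A(w,-i),\quad w\in\mathbb{C}^+.$$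 $B$ is a contractive $2\times2$ matrix-valued analytic function on $\mathbb{C}^+$. The spectral (Clark) measure of $L_{2,\alpha}$ is $\mu^{B\alpha^*}$, defined as follows. Let $\gamma(w)=\frac{w-i}{w+i}$ be the Cayley transform from $\mathbb{C}^+$ onto the unit disk $\mathbb{D}$ (mapping $\mathbb{R}$ onto $\mathbb{T}\setminus\{1\}$), and $B(w)=b(\gamma(w))$. Then $\mu^{b\alpha^*}$ is the unique nonnegative $2\times2$ matrix-valued Borel measure on $\mathbb{T}$ with $\operatorname{Re}[(I-b(\zeta)\alpha^* )^{-1}(I+b(\zeta)\alpha^* )]=\int_{\mathbb{T}}\frac{1-|\zeta|^2}{|\lambda-\zeta|^2}\mu^{b\alpha^*}(d\lambda)$ for $\zeta\in\mathbb{D}$, with $\operatorname{Re}X=\frac12(X+X^* )$, and $\mu^{B\alpha^*}(\Omega)=\int_\Omega\frac{1}{\pi(1+t^2)}(\mu^{b\alpha^*}\circ\gamma)(dt)$ for Borel $\Omega\subseteq\mathbb{R}$, where $(\mu^{b\alpha^*}\circ\gamma)(\Omega)=\mu^{b\alpha^*}(\gamma(\Omega))$. *)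

theory Defs
  imports "HOL-Analysis.Analysis"
begin

section \<open>The maximal operator on the interval\<close>

definition abs_continuous_on :: "real \<Rightarrow> real \<Rightarrow> (real \<Rightarrow> complex) \<Rightarrow> bool" where
  "abs_continuous_on c d f \<longleftrightarrow>
     (\<forall>\<epsilon>>0. \<exists>\<delta>>0. \<forall>(n::nat) u v.
        (\<forall>i<n. c \<le> u i \<and> u i \<le> v i \<and> v i \<le> d) \<longrightarrow>
        disjoint_family_on (\<lambda>i. {u i<..<v i}) {..<n} \<longrightarrow>
        (\<Sum>i<n. v i - u i) < \<delta> \<longrightarrow>
        (\<Sum>i<n. norm (f (v i) - f (u i))) < \<epsilon>)"

definition AC_loc :: "real \<Rightarrow> (real \<Rightarrow> complex) \<Rightarrow> bool" where
  "AC_loc a f \<longleftrightarrow> (\<forall>c d. - a < c \<longrightarrow> c \<le> d \<longrightarrow> d < a \<longrightarrow> abs_continuous_on c d f)"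

abbreviation L2_space :: "real \<Rightarrow> real measure" where
  "L2_space a \<equiv> lebesgue_on {- a<..<a}"

definition in_L2 :: "real \<Rightarrow> (real \<Rightarrow> complex) \<Rightarrow> bool" where
  "in_L2 a f \<longleftrightarrow> f \<in> borel_measurable (L2_space a) \<and> integrable (L2_space a) (\<lambda>x. (norm (f x))\<^sup>2)"

definition L2_inner :: "real \<Rightarrow> (real \<Rightarrow> complex) \<Rightarrow> (real \<Rightarrow> complex) \<Rightarrow> complex" where
  "L2_inner a f g = (LINT x|L2_space a. f x * cnj (g x))"

abbreviation D :: "(real \<Rightarrow> complex) \<Rightarrow> real \<Rightarrow> complex" where
  "D f \<equiv> (\<lambda>x. vector_derivative f (at x))"

text \<open>Elements of the domain are represented by functions on the line of which only the
  restriction to the open interval from \<open>- a\<close> to \<open>a\<close> matters. A locally absolutely continuous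
  function whose derivative is (almost everywhere) defined and locally absolutely continuous
  is continuously differentiable, so \<open>D f\<close> is then the honest derivative at every point of the
  interval; \<open>D (D f)\<close> is the honest derivative of \<open>D f\<close> almost everywhere.\<close>

definition dom_L2max :: "real \<Rightarrow> (real \<Rightarrow> complex) set" where
  "dom_L2max a = {f. in_L2 a f \<and> AC_loc a f \<and> AC_loc a (D f) \<and> in_L2 a (D (D f))}"

definition L2max :: "(real \<Rightarrow> complex) \<Rightarrow> real \<Rightarrow> complex" where
  "L2max f = (\<lambda>x. - D (D f) x)"

definition ker_L2max :: "real \<Rightarrow> complex \<Rightarrow> (real \<Rightarrow> complex) set" where
  "ker_L2max a z = {f \<in> dom_L2max a. AE x in L2_space a. L2max f x - z * f x = 0}"

section \<open>The characteristic function\<close>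

text \<open>The index \<open>k\<close> ranges over the two-element type \<open>2\<close>, in which \<open>2 = 0\<close>;
  hence the sign \<open>(-1)^k\<close> is spelled out.\<close>

definition phi :: "complex \<Rightarrow> 2 \<Rightarrow> real \<Rightarrow> complex" where
  "phi w k = (\<lambda>x. exp ((if k = 1 then - 1 else 1) * \<i> * csqrt w * of_real x))"

definition deficiency_onb :: "real \<Rightarrow> complex \<Rightarrow> (2 \<Rightarrow> real \<Rightarrow> complex) \<Rightarrow> bool" where
  "deficiency_onb a z \<psi> \<longleftrightarrow>
     (\<forall>k. \<psi> k \<in> ker_L2max a z) \<and>
     (\<forall>k. \<exists>c. \<forall>x\<in>{- a<..<a}. \<psi> k x = (\<Sum>j\<in>UNIV. c j * phi z j x)) \<and>
     (\<forall>k l. L2_inner a (\<psi> k) (\<psi> l) = (if k = l then 1 else 0)) \<and>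
     (\<forall>f\<in>ker_L2max a z. \<exists>c. \<forall>x\<in>{- a<..<a}. f x = (\<Sum>k\<in>UNIV. c k * \<psi> k x))"

definition cayley :: "complex \<Rightarrow> complex" where
  "cayley w = (w - \<i>) / (w + \<i>)"

text \<open>\<open>\<psi> z\<close> is the chosen orthonormal basis of the kernel at \<open>z = \<i>\<close> and \<open>z = - \<i>\<close>.\<close>

definition A_mat :: "real \<Rightarrow> (complex \<Rightarrow> 2 \<Rightarrow> real \<Rightarrow> complex) \<Rightarrow> complex \<Rightarrow> complex \<Rightarrow> complex^2^2" where
  "A_mat a \<psi> w z = (\<chi> j l. L2_inner a (phi w j) (\<psi> z l))"

definition livsic :: "real \<Rightarrow> (complex \<Rightarrow> 2 \<Rightarrow> real \<Rightarrow> complex) \<Rightarrow> complex \<Rightarrow> complex^2^2" where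
  "livsic a \<psi> w = mat (cayley w) ** matrix_inv (A_mat a \<psi> w \<i>) ** A_mat a \<psi> w (- \<i>)"

section \<open>Complex matrices and matrix-valued measures\<close>

definition ctranspose :: "complex^2^2 \<Rightarrow> complex^2^2" where
  "ctranspose M = (\<chi> i j. cnj (M $ j $ i))"

definition unitary_mat :: "complex^2^2 \<Rightarrow> bool" where
  "unitary_mat M \<longleftrightarrow> M ** ctranspose M = mat 1 \<and> ctranspose M ** M = mat 1"

definition Re_mat :: "complex^2^2 \<Rightarrow> complex^2^2" where
  "Re_mat X = (1/2) *\<^sub>R (X + ctranspose X)"

definition qform :: "complex^2^2 \<Rightarrow> complex^2 \<Rightarrow> complex" where
  "qform M v = (\<Sum>i\<in>UNIV. (M *v v) $ i * cnj (v $ i))"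

definition nonneg_mat :: "complex^2^2 \<Rightarrow> bool" where
  "nonneg_mat M \<longleftrightarrow> (\<forall>v. qform M v \<in> \<real> \<and> 0 \<le> Re (qform M v))"

text \<open>A nonnegative matrix-valued measure on the \<open>\<sigma>\<close>-algebra of \<open>N\<close> (the measure carried
  by \<open>N\<close> itself is irrelevant).\<close>

definition nonneg_mat_measure :: "'a measure \<Rightarrow> ('a set \<Rightarrow> complex^2^2) \<Rightarrow> bool" where
  "nonneg_mat_measure N \<mu> \<longleftrightarrow>
     (\<forall>\<Omega>\<in>sets N. nonneg_mat (\<mu> \<Omega>)) \<and>
     (\<forall>F::nat \<Rightarrow> 'a set. range F \<subseteq> sets N \<longrightarrow> disjoint_family F \<longrightarrow>
        (\<lambda>n. \<mu> (F n)) sums \<mu> (\<Union>n. F n))"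

definition scalar_measure :: "'a measure \<Rightarrow> ('a set \<Rightarrow> complex^2^2) \<Rightarrow> complex^2 \<Rightarrow> 'a measure" where
  "scalar_measure N \<mu> v = measure_of (space N) (sets N) (\<lambda>\<Omega>. ennreal (Re (qform (\<mu> \<Omega>) v)))"

text \<open>The integral of a scalar function against a nonnegative matrix-valued measure is the matrix
  whose quadratic form at each \<open>v\<close> is the integral against the scalar measure
  \<open>\<Omega> \<mapsto> \<langle>\<mu>(\<Omega>) v, v\<rangle>\<close>; by polarization this is the entrywise integral, and the
  matrix is unique (\<open>qform_eq_imp_eq\<close> below).\<close>

definition has_mat_integral ::
    "'a measure \<Rightarrow> ('a set \<Rightarrow> complex^2^2) \<Rightarrow> ('a \<Rightarrow> real) \<Rightarrow> complex^2^2 \<Rightarrow> bool" where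
  "has_mat_integral N \<mu> f M \<longleftrightarrow>
     (\<forall>v. integrable (scalar_measure N \<mu> v) f \<and>
          qform M v = of_real (LINT x|scalar_measure N \<mu> v. f x))"

lemma qform_eq_imp_eq:
  assumes "\<And>v. qform M v = qform M' v"
  shows "M = M'"
proof -
  have q: "qform X (\<chi> k. if k = 1 then p else r) =
      X$1$1 * p * cnj p + X$1$2 * r * cnj p + X$2$1 * p * cnj r + X$2$2 * r * cnj r" for X p r
    by (simp add: qform_def matrix_vector_mult_def sum_2 algebra_simps)
  note e = assms[of "\<chi> k. if k = 1 then p else r" for p r, unfolded q]
  have 1: "M$1$1 = M'$1$1" and 2: "M$2$2 = M'$2$2"
    using e[of 1 0] e[of 0 1] by simp_all
  have 3: "M$1$2 + M$2$1 = M'$1$2 + M'$2$1"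
    using e[of 1 1] 1 2 by (simp add: algebra_simps)
  have "\<i> * (M$1$2 - M$2$1) = \<i> * (M'$1$2 - M'$2$1)"
    using e[of 1 \<i>] 1 2 by (simp add: algebra_simps)
  hence 4: "M$1$2 - M$2$1 = M'$1$2 - M'$2$1"
    by simp
  have "2 * M$1$2 = 2 * M'$1$2" "2 * M$2$1 = 2 * M'$2$1"
    using 3 4 by algebra+
  with 1 2 show ?thesis
    by (simp add: vec_eq_iff forall_2)
qed

section \<open>Clark measures\<close>

abbreviation circle_borel :: "complex measure" where
  "circle_borel \<equiv> restrict_space borel (sphere 0 1)"

definition disk_version :: "(complex \<Rightarrow> complex^2^2) \<Rightarrow> complex \<Rightarrow> complex^2^2" where
  "disk_version B \<zeta> = B (\<i> * (1 + \<zeta>) / (1 - \<zeta>))"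

lemma disk_version_cayley:
  assumes "0 < Im w"
  shows "B w = disk_version B (cayley w)"
proof -
  have "w + \<i> \<noteq> 0" using assms by (auto simp: complex_eq_iff)
  hence "1 + cayley w = 2 * w / (w + \<i>)" "1 - cayley w = 2 * \<i> / (w + \<i>)"
    by (simp_all add: cayley_def field_simps)
  with \<open>w + \<i> \<noteq> 0\<close> have "\<i> * (1 + cayley w) / (1 - cayley w) = w"
    by simp
  thus ?thesis by (simp add: disk_version_def)
qed

definition clark_measure ::
    "(complex \<Rightarrow> complex^2^2) \<Rightarrow> complex^2^2 \<Rightarrow> (complex set \<Rightarrow> complex^2^2) \<Rightarrow> bool" where
  "clark_measure b \<alpha> \<mu> \<longleftrightarrow>
     nonneg_mat_measure circle_borel \<mu> \<and>
     (\<forall>\<zeta>\<in>ball 0 1.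
        has_mat_integral circle_borel \<mu> (\<lambda>\<xi>. (1 - (norm \<zeta>)\<^sup>2) / (norm (\<xi> - \<zeta>))\<^sup>2)
          (Re_mat (matrix_inv (mat 1 - b \<zeta> ** ctranspose \<alpha>) ** (mat 1 + b \<zeta> ** ctranspose \<alpha>))))"

definition cayley_pullback :: "(complex set \<Rightarrow> complex^2^2) \<Rightarrow> real set \<Rightarrow> complex^2^2" where
  "cayley_pullback \<mu> \<Omega> = \<mu> ((\<lambda>t. cayley (of_real t)) ` \<Omega>)"

definition spectral_measure ::
    "(complex \<Rightarrow> complex^2^2) \<Rightarrow> complex^2^2 \<Rightarrow> (real set \<Rightarrow> complex^2^2) \<Rightarrow> bool" where
  "spectral_measure B \<alpha> \<nu> \<longleftrightarrow>
     (\<exists>\<mu>. clark_measure (disk_version B) \<alpha> \<mu> \<and>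
        (\<forall>\<Omega>\<in>sets borel. has_mat_integral borel (cayley_pullback \<mu>)
            (\<lambda>t. indicator \<Omega> t * (1 / (pi * (1 + t\<^sup>2)))) (\<nu> \<Omega>)))"

section \<open>Non-tangential limits\<close>

definition nontangential_limit :: "(complex \<Rightarrow> complex^2^2) \<Rightarrow> real \<Rightarrow> complex^2^2 \<Rightarrow> bool" where
  "nontangential_limit F s M \<longleftrightarrow>
     (\<forall>\<kappa>>1. (F \<longlongrightarrow> M) (at (of_real s) within {w. 0 < Im w \<and> norm (w - of_real s) < \<kappa> * Im w}))"

end

theory Submission
  imports Defs
begin

text \<open>
  Let \<open>c w\<close> and \<open>e w\<close> be the pairings of a fundamental system of \<open>- f'' = w f\<close>, entire in
  \<open>w\<close>, with the deficiency bases under the boundary form of Green's formula. Green's formula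
  absorbs the factor \<open>(w - \<i>) / (w + \<i>)\<close>, so that \<open>B w = (c w)\<^sup>-\<^sup>1 (e w)\<close>, and \<open>c s\<close> is still
  invertible at real \<open>s\<close>. Write \<open>G w = B w \<alpha>\<^sup>*\<close> and let \<open>v\<close> lie in the kernel of the limit of
  \<open>1 - G w\<close> at \<open>s\<close>. Since \<open>c\<close> and \<open>e\<close> are differentiable at \<open>s\<close>, the norm of \<open>(1 - G w) v\<close> is
  \<open>O(\<epsilon>)\<close> at \<open>w = s + \<i> \<epsilon>\<close>. On the other hand, with \<open>r = v\<^sup>* (1 - G w)\<^sup>-\<^sup>1\<close>, the Poisson integral of
  the scalar Clark measure at \<open>v\<close> equals \<open>|r|\<^sup>2 - |r G w|\<^sup>2\<close>. Krein's identity and Bessel's inequality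
  give \<open>|r G w| \<le> |(w - \<i>) / (w + \<i>)| |r|\<close>, and \<open>|v|\<^sup>2 \<le> |r| |(1 - G w) v|\<close>, so this Poisson
  integral is at least a constant times \<open>1 / \<epsilon>\<close>. By dominated convergence that growth forces
  a point mass.
\<close>

section \<open>Matrices of size two\<close>

lemma norm_vec_squared: "(norm (v :: 'a::real_normed_vector^'n))\<^sup>2 = (\<Sum>i\<in>UNIV. (norm (v $ i))\<^sup>2)"
  by (simp add: norm_vec_def L2_set_def sum_nonneg)

lemma norm_unitary:
  assumes "unitary_mat U"
  shows "norm (r v* U) = norm r"
proof -
  have *: "complex_of_real ((norm (x :: complex^2))\<^sup>2) = (\<Sum>i\<in>UNIV. x $ i * cnj (x $ i))" for x
    by (simp add: norm_vec_squared complex_norm_square del: of_real_power)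
  have e: "(\<Sum>k\<in>UNIV. U $ i $ k * cnj (U $ j $ k)) = (if i = j then 1 else 0)" for i j
    using assms unfolding unitary_mat_def
    by (auto simp: matrix_matrix_mult_def ctranspose_def mat_def vec_eq_iff)
  have "(\<Sum>i\<in>UNIV. (r v* U) $ i * cnj ((r v* U) $ i)) =
     (\<Sum>i\<in>UNIV. \<Sum>j\<in>UNIV. r $ i * cnj (r $ j) * (\<Sum>k\<in>UNIV. U $ i $ k * cnj (U $ j $ k)))"
    by (simp add: vector_matrix_mult_def sum_2 algebra_simps)
  also have "\<dots> = (\<Sum>i\<in>UNIV. r $ i * cnj (r $ i))"
    by (simp add: e sum_2)
  finally have "complex_of_real ((norm (r v* U))\<^sup>2) = complex_of_real ((norm r)\<^sup>2)"
    by (simp only: *)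
  thus ?thesis by (simp only: of_real_eq_iff) simp
qed

lemma unitary_ctranspose: "unitary_mat U \<Longrightarrow> unitary_mat (ctranspose U)"
proof -
  have "ctranspose (ctranspose U) = U" by (simp add: ctranspose_def vec_eq_iff)
  thus "unitary_mat U \<Longrightarrow> unitary_mat (ctranspose U)" by (simp add: unitary_mat_def)
qed

lemma vector_matrix_dot:
  fixes x y :: "complex^2"
  shows "(\<Sum>i\<in>UNIV. (x v* A) $ i * y $ i) = (\<Sum>i\<in>UNIV. x $ i * (A *v y) $ i)"
  by (simp add: vector_matrix_mult_def matrix_vector_mult_def sum_2 algebra_simps)

text \<open>Coefficients of solutions act as row vectors throughout, so the kernel criterion for
  columns is applied to the transpose.\<close>

lemma invertible_vector_matrix:
  fixes A :: "complex^'n^'n"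
  assumes "\<And>r. r v* A = 0 \<Longrightarrow> r = 0"
  shows "invertible A"
proof -
  have "\<forall>x. transpose A *v x = 0 \<longrightarrow> x = 0"
    using assms by (simp add: transpose_matrix_vector)
  hence "\<exists>B. B ** transpose A = mat 1" by (simp only: matrix_left_invertible_ker)
  then obtain B where "B ** transpose A = mat 1" by blast
  hence "transpose (B ** transpose A) = mat 1" by simp
  hence "A ** transpose B = mat 1" by (simp add: matrix_transpose_mul)
  thus ?thesis using invertible_right_inverse by blast
qed

lemma matrix_inv_right_inverse: "invertible A \<Longrightarrow> A ** matrix_inv A = mat 1"
  and matrix_inv_left_inverse: "invertible A \<Longrightarrow> matrix_inv A ** A = mat 1"
  for A :: "'a::semiring_1^'n^'n"
  unfolding invertible_def matrix_inv_def by (metis (mono_tags, lifting) someI_ex)+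

lemma qform_ctranspose: "qform (ctranspose X) v = cnj (qform X v)"
  by (simp add: qform_def ctranspose_def matrix_vector_mult_def sum_2 algebra_simps)

lemma qform_Re_mat: "qform (Re_mat X) v = of_real (Re (qform X v))"
proof -
  have "qform (Re_mat X) v = (qform X v + qform (ctranspose X) v) / 2"
    by (simp add: qform_def Re_mat_def matrix_vector_mult_def sum_2 scaleR_conv_of_real[where 'a=complex] field_simps)
  thus ?thesis by (simp add: qform_ctranspose complex_add_cnj)
qed

text \<open>With \<open>r = v\<^sup>* (1 - G)\<^sup>-\<^sup>1\<close> the form is \<open>Re \<langle>r + r G, r - r G\<rangle>\<close>.\<close>

lemma qform_Re_mat_cayley:
  fixes G :: "complex^2^2" and v :: "complex^2"
  assumes "invertible (mat 1 - G)"
  defines "r \<equiv> (\<chi> i. cnj (v $ i)) v* matrix_inv (mat 1 - G)"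
  shows "qform (Re_mat (matrix_inv (mat 1 - G) ** (mat 1 + G))) v =
    of_real ((norm r)\<^sup>2 - (norm (r v* G))\<^sup>2)"
proof -
  let ?X = "matrix_inv (mat 1 - G) ** (mat 1 + G)"
  let ?u = "(\<chi> i. cnj (v $ i)) :: complex^2"
  have "r v* (mat 1 - G) = ?u"
    by (simp add: r_def vector_matrix_mul_assoc matrix_inv_left_inverse assms)
  hence u: "?u = r - r v* G" by (simp add: vector_matrix_mul_rid vector_matrix_mult_diff_rdistrib)
  have v: "v $ i = cnj ((r - r v* G) $ i)" for i
    unfolding u[symmetric] by simp
  have "qform ?X v = (\<Sum>i\<in>UNIV. ?u $ i * (?X *v v) $ i)"
    by (simp add: qform_def mult.commute)
  also have "\<dots> = (\<Sum>i\<in>UNIV. (?u v* ?X) $ i * v $ i)" by (simp only: vector_matrix_dot)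
  also have "?u v* ?X = r + r v* G"
    by (simp add: r_def vector_matrix_mul_assoc[symmetric] vector_matrix_mult_add_rdistrib)
  finally have "qform ?X v = (\<Sum>i\<in>UNIV. (r + r v* G) $ i * cnj ((r - r v* G) $ i))"
    by (simp only: v)
  \<comment> \<open>The two cross terms are negative conjugates of each other, so their sum is
    purely imaginary.\<close>
  also have "Re \<dots> = (norm r)\<^sup>2 - (norm (r v* G))\<^sup>2"
    unfolding norm_vec_squared sum_2 cmod_power2 by (simp add: power2_eq_square algebra_simps)
  finally show ?thesis by (simp add: qform_Re_mat)
qed

section \<open>Point masses of Clark measures\<close>

lemma bounded_linear_Re_qform: "bounded_linear (\<lambda>M. Re (qform M v))"
proof -
  have "linear (\<lambda>M. Re (qform M v))"
    by (rule linearI) (simp_all add: qform_def matrix_vector_mult_def sum_2 algebra_simps)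
  thus ?thesis by (simp add: linear_conv_bounded_linear)
qed

text \<open>\<open>measure_of\<close> takes the prescribed values only for a positive, countably
  additive set function. Additivity passes through the bounded linear map that sends a matrix to the
  real part of its form at \<open>v\<close>.\<close>

lemma emeasure_scalar_measure:
  assumes N: "nonneg_mat_measure N \<mu>" and \<Omega>: "\<Omega> \<in> sets N"
  shows "emeasure (scalar_measure N \<mu> v) \<Omega> = ennreal (Re (qform (\<mu> \<Omega>) v))"
proof (rule emeasure_measure_of[OF scalar_measure_def])
  let ?f = "\<lambda>\<Omega>. ennreal (Re (qform (\<mu> \<Omega>) v))"
  have sets: "sets (scalar_measure N \<mu> v) = sets N"
    by (simp add: scalar_measure_def sets.space_closed sets.sigma_sets_eq)
  have sums: "(\<lambda>n. \<mu> (F n)) sums \<mu> (\<Union>n. F n)"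
    if "range F \<subseteq> sets N" "disjoint_family F" for F :: "nat \<Rightarrow> _"
    using N that by (simp add: nonneg_mat_measure_def)
  \<comment> \<open>The constant sequence \<open>\<mu> {}\<close> is summable, hence tends to 0,
    which forces \<open>\<mu> {} = 0\<close>.\<close>
  have "(\<lambda>n::nat. \<mu> {}) sums \<mu> {}"
    using sums[of "\<lambda>_. {}"] by (simp add: disjoint_family_on_def)
  hence "(\<lambda>n::nat. \<mu> {}) \<longlonglongrightarrow> 0" by (intro summable_LIMSEQ_zero) (rule sums_summable)
  hence "\<mu> {} = 0" by (simp add: LIMSEQ_const_iff)
  thus "positive (sets (scalar_measure N \<mu> v)) ?f"
    by (simp add: positive_def qform_def)
  show "countably_additive (sets (scalar_measure N \<mu> v)) ?f"
    unfolding sets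
  proof (rule countably_additiveI)
    fix F :: "nat \<Rightarrow> _"
    assume F: "range F \<subseteq> sets N" "disjoint_family F"
    have "(\<lambda>n. Re (qform (\<mu> (F n)) v)) sums Re (qform (\<mu> (\<Union>n. F n)) v)"
      by (rule bounded_linear.sums[OF bounded_linear_Re_qform sums[OF F]])
    moreover have "0 \<le> Re (qform (\<mu> (F n)) v)" for n
      using N F by (auto simp: nonneg_mat_measure_def nonneg_mat_def)
    ultimately show "(\<Sum>n. ?f (F n)) = ?f (\<Union>n. F n)"
      by (intro suminf_ennreal_eq)
  qed
  show "\<Omega> \<in> sets (scalar_measure N \<mu> v)" using \<Omega> by (simp add: sets)
qed (rule sets.space_closed)

lemma space_scalar_measure [simp]: "space (scalar_measure N \<mu> v) = space N"
  by (simp add: scalar_measure_def space_measure_of_conv)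

lemma sets_scalar_measure [simp]: "sets (scalar_measure N \<mu> v) = sets N"
  by (simp add: scalar_measure_def sets.space_closed sets.sigma_sets_eq)

section \<open>The Cayley transform of the real line and pulled back measures\<close>

lemma cayley_real_denom: "complex_of_real t + \<i> \<noteq> 0"
  by (auto simp: complex_eq_iff)

lemma norm_cayley_real: "norm (cayley (complex_of_real t)) = 1"
proof -
  have "norm (complex_of_real t - \<i>) = norm (complex_of_real t + \<i>)"
    by (simp add: cmod_def)
  thus ?thesis using cayley_real_denom[of t] by (simp add: cayley_def norm_divide)
qed

lemma cayley_inverse:
  assumes "w + \<i> \<noteq> 0"
  shows "cayley w \<noteq> 1" "\<i> * (1 + cayley w) / (1 - cayley w) = w"
proof -
  have "1 + cayley w = 2 * w / (w + \<i>)" "1 - cayley w = 2 * \<i> / (w + \<i>)"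
    using assms by (simp_all add: cayley_def field_simps)
  with assms show "\<i> * (1 + cayley w) / (1 - cayley w) = w" "cayley w \<noteq> 1"
    by auto
qed

lemma inj_cayley_real: "inj (\<lambda>t. cayley (complex_of_real t))"
proof (rule injI)
  fix t t' assume e: "cayley (complex_of_real t) = cayley (complex_of_real t')"
  have "complex_of_real t = \<i> * (1 + cayley (of_real t)) / (1 - cayley (of_real t))"
    by (simp only: cayley_inverse(2)[OF cayley_real_denom])
  also have "\<dots> = of_real t'"
    by (simp only: e cayley_inverse(2)[OF cayley_real_denom])
  finally show "t = t'" by simp
qed

text \<open>The inverse transform is a Borel function, so the image is the trace on the circle of a
  Borel preimage.\<close>

lemma cayley_real_image_measurable:
  assumes "\<Omega> \<in> sets borel"
  shows "(\<lambda>t. cayley (complex_of_real t)) ` \<Omega> \<in> sets circle_borel"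
proof -
  let ?g = "\<lambda>\<xi>. \<i> * (1 + \<xi>) / (1 - \<xi>) :: complex"
  have r: "\<xi> = cayley (complex_of_real (Re (?g \<xi>)))" if "norm \<xi> = 1" "\<xi> \<noteq> 1" for \<xi>
  proof -
    \<comment> \<open>On the circle \<open>cnj \<xi>\<close> is the inverse of \<open>\<xi>\<close>,
      which makes \<open>?g \<xi>\<close> real.\<close>
    have "cnj (?g \<xi>) = ?g \<xi>"
    proof -
      have "\<xi> * cnj \<xi> = 1" using that by (metis complex_norm_square of_real_1 power_one)
      moreover have "cnj \<xi> \<noteq> 1" using that by (metis complex_cnj_cnj complex_cnj_one)
      ultimately show ?thesis using that
        by (simp add: divide_simps) (simp add: algebra_simps)
    qed
    hence "?g \<xi> \<in> \<real>" by (simp add: Reals_cnj_iff)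
    hence e: "complex_of_real (Re (?g \<xi>)) = ?g \<xi>" by simp
    have "?g \<xi> - \<i> = 2 * \<i> * \<xi> / (1 - \<xi>)" "?g \<xi> + \<i> = 2 * \<i> / (1 - \<xi>)"
      using that by (simp_all add: field_simps)
    thus ?thesis using that unfolding e cayley_def by simp
  qed
  \<comment> \<open>The point 1 is not attained and has to be removed by hand: division by zero
    gives \<open>?g 1 = 0\<close>, so it would otherwise be counted whenever 0 lies in
    \<open>\<Omega>\<close>.\<close>
  have "(\<lambda>t. cayley (complex_of_real t)) ` \<Omega> =
      sphere 0 1 \<inter> (((\<lambda>\<xi>. Re (?g \<xi>)) -` \<Omega> \<inter> space borel) - {1})"
    (is "?L = ?R")
  proof
    show "?L \<subseteq> ?R"
      using cayley_inverse[OF cayley_real_denom] by (auto simp: norm_cayley_real)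
    show "?R \<subseteq> ?L"
    proof
      fix \<xi> assume "\<xi> \<in> ?R"
      hence "norm \<xi> = 1" "\<xi> \<noteq> 1" "Re (?g \<xi>) \<in> \<Omega>" by auto
      with r show "\<xi> \<in> ?L" by blast
    qed
  qed
  moreover have "(\<lambda>\<xi>. Re (?g \<xi>)) \<in> borel_measurable borel" by measurable
  hence "((\<lambda>\<xi>. Re (?g \<xi>)) -` \<Omega> \<inter> space borel) - {1} \<in> sets borel"
    using assms by (intro sets.Diff measurable_sets) auto
  ultimately show ?thesis by (auto simp: sets_restrict_space)
qed

text \<open>Injectivity of the transform keeps images of disjoint sets disjoint, so additivity is
  inherited from the circle. This gives the scalar measures behind \<open>spectral_measure\<close>
  their intended values.\<close>

lemma nonneg_mat_measure_cayley_pullback: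
  assumes "nonneg_mat_measure circle_borel \<mu>"
  shows "nonneg_mat_measure borel (cayley_pullback \<mu>)"
  unfolding nonneg_mat_measure_def
proof (intro conjI ballI allI impI)
  fix \<Omega> :: "real set" assume "\<Omega> \<in> sets borel"
  thus "nonneg_mat (cayley_pullback \<mu> \<Omega>)"
    using assms cayley_real_image_measurable
    by (auto simp: cayley_pullback_def nonneg_mat_measure_def)
next
  fix F :: "nat \<Rightarrow> real set"
  assume F: "range F \<subseteq> sets borel" "disjoint_family F"
  let ?G = "\<lambda>n. (\<lambda>t. cayley (complex_of_real t)) ` F n"
  have "range ?G \<subseteq> sets circle_borel"
    using F(1) cayley_real_image_measurable by blast
  moreover have "disjoint_family ?G"
    using F(2) inj_cayley_real by (auto simp: disjoint_family_on_def inj_def) blast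
  ultimately have "(\<lambda>n. \<mu> (?G n)) sums \<mu> (\<Union>n. ?G n)"
    using assms unfolding nonneg_mat_measure_def by blast
  thus "(\<lambda>n. cayley_pullback \<mu> (F n)) sums cayley_pullback \<mu> (\<Union>n. F n)"
    by (simp add: cayley_pullback_def image_UN)
qed

section \<open>The Poisson kernel and point masses\<close>

lemma one_minus_norm_cayley:
  assumes "0 < Im w"
  shows "1 - (norm (cayley w))\<^sup>2 = 4 * Im w / (norm (w + \<i>))\<^sup>2"
proof -
  have n: "norm (w + \<i>) \<noteq> 0" using assms by (auto simp: complex_eq_iff)
  have "(norm (w + \<i>))\<^sup>2 - (norm (w - \<i>))\<^sup>2 = 4 * Im w"
    by (simp add: cmod_power2) (simp add: power2_eq_square algebra_simps)
  with n show ?thesis by (simp add: cayley_def norm_divide power_divide divide_simps)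
qed

text \<open>The distance of \<open>\<xi>\<close> from \<open>\<zeta>\<close> is at least
  \<open>1 - norm \<zeta>\<close>, and \<open>1 + norm \<zeta>\<close> is at most 2. At the
  transform of \<open>s + \<i> \<epsilon>\<close> the bound is of order
  \<open>1 / \<epsilon>\<close>, which makes the rescaled kernels bounded.\<close>

lemma poisson_le:
  assumes "norm \<zeta> < 1" "norm \<xi> = 1"
  shows "(1 - (norm \<zeta>)\<^sup>2) / (norm (\<xi> - \<zeta>))\<^sup>2 \<le> 4 / (1 - (norm (\<zeta>::complex))\<^sup>2)"
proof -
  let ?x = "norm \<zeta>"
  have d: "1 - ?x \<le> norm (\<xi> - \<zeta>)" using assms norm_triangle_ineq2[of \<xi> \<zeta>] by simp
  have p: "0 < 1 - ?x\<^sup>2" using assms by (simp add: power_less_one_iff abs_square_less_1)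
  have "(1 - ?x\<^sup>2)\<^sup>2 = (1 + ?x)\<^sup>2 * (1 - ?x)\<^sup>2" by (simp add: power2_eq_square algebra_simps)
  also have "\<dots> \<le> 2\<^sup>2 * (norm (\<xi> - \<zeta>))\<^sup>2"
    using assms d by (intro mult_mono power_mono) auto
  finally have "(1 - ?x\<^sup>2) * (1 - ?x\<^sup>2) \<le> 4 * (norm (\<xi> - \<zeta>))\<^sup>2" by (simp add: power2_eq_square)
  moreover have "0 < norm (\<xi> - \<zeta>)" using d assms by linarith
  hence "0 < (norm (\<xi> - \<zeta>))\<^sup>2" by simp
  ultimately show ?thesis using p by (simp add: divide_simps)
qed

text \<open>If the point mass at \<open>cayley s\<close> vanished, the rescaled Poisson kernels
  \<open>\<epsilon> * P (cayley (s + \<i> \<epsilon>), \<xi>)\<close>, which are bounded and tend to \<open>0\<close> for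
  \<open>\<xi> \<noteq> cayley s\<close>, would have integrals tending to \<open>0\<close>.\<close>

lemma clark_measure_atom:
  assumes \<mu>: "clark_measure (disk_version B) \<alpha> \<mu>" and k: "0 < k"
    and lower: "eventually (\<lambda>\<epsilon>. k / \<epsilon> \<le> Re (qform (Re_mat
        (matrix_inv (mat 1 - B (Complex s \<epsilon>) ** ctranspose \<alpha>) **
        (mat 1 + B (Complex s \<epsilon>) ** ctranspose \<alpha>))) v)) (at_right 0)"
  shows "0 < Re (qform (\<mu> {cayley (complex_of_real s)}) v)"
proof -
  define m where "m = scalar_measure circle_borel \<mu> v"
  define p where "p = cayley (complex_of_real s)"
  define \<zeta> where "\<zeta> \<epsilon> = cayley (Complex s \<epsilon>)" for \<epsilon>
  define P where "P \<epsilon> \<xi> = (1 - (norm (\<zeta> \<epsilon>))\<^sup>2) / (norm (\<xi> - \<zeta> \<epsilon>))\<^sup>2" for \<epsilon> \<xi>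
  have nn: "nonneg_mat_measure circle_borel \<mu>" using \<mu> by (simp add: clark_measure_def)
  have p1: "norm p = 1" by (simp add: p_def norm_cayley_real)
  have ps: "{p} \<in> sets circle_borel" using p1 by (auto simp: sets_restrict_space)
  have \<zeta>1: "norm (\<zeta> \<epsilon>) < 1" if "0 < \<epsilon>" for \<epsilon>
  proof -
    have "0 < 1 - (norm (\<zeta> \<epsilon>))\<^sup>2"
      using that one_minus_norm_cayley[of "Complex s \<epsilon>"] by (auto simp: \<zeta>_def complex_eq_iff)
    thus ?thesis by (simp add: abs_square_less_1)
  qed
  have int: "integrable m (P \<epsilon>)"
    and LINT: "qform (Re_mat (matrix_inv (mat 1 - B (Complex s \<epsilon>) ** ctranspose \<alpha>) **
        (mat 1 + B (Complex s \<epsilon>) ** ctranspose \<alpha>))) v = of_real (LINT \<xi>|m. P \<epsilon> \<xi>)"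
    if "0 < \<epsilon>" for \<epsilon>
  proof -
    have "B (Complex s \<epsilon>) = disk_version B (\<zeta> \<epsilon>)"
      using that disk_version_cayley[of "Complex s \<epsilon>" B] by (simp add: \<zeta>_def)
    moreover have "\<zeta> \<epsilon> \<in> ball 0 1" using \<zeta>1 that by simp
    ultimately show "integrable m (P \<epsilon>)" "qform (Re_mat (matrix_inv (mat 1 - B (Complex s \<epsilon>) ** ctranspose \<alpha>) **
        (mat 1 + B (Complex s \<epsilon>) ** ctranspose \<alpha>))) v = of_real (LINT \<xi>|m. P \<epsilon> \<xi>)"
      using \<mu> unfolding clark_measure_def has_mat_integral_def m_def P_def[abs_def]
      by auto
  qed
  have fin: "finite_measure m"
  proof (rule finite_measureI)
    have "space m \<in> sets circle_borel" using sets.top[of circle_borel] by (simp add: m_def)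
    thus "emeasure m (space m) \<noteq> \<infinity>"
      using emeasure_scalar_measure[OF nn, of "space m" v] by (simp add: m_def)
  qed
  obtain \<delta> where \<delta>: "0 < \<delta>" "\<And>\<epsilon>. 0 < \<epsilon> \<Longrightarrow> \<epsilon> < \<delta> \<Longrightarrow> k / \<epsilon> \<le> (LINT \<xi>|m. P \<epsilon> \<xi>)"
  proof -
    obtain \<delta> where d: "0 < \<delta>" "\<And>\<epsilon>. 0 < \<epsilon> \<Longrightarrow> \<epsilon> < \<delta> \<Longrightarrow> k / \<epsilon> \<le> Re (qform (Re_mat
        (matrix_inv (mat 1 - B (Complex s \<epsilon>) ** ctranspose \<alpha>) **
        (mat 1 + B (Complex s \<epsilon>) ** ctranspose \<alpha>))) v)"
      using lower unfolding eventually_at_right_field by auto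
    show ?thesis using d LINT by (intro that[of \<delta>]) auto
  qed
  \<comment> \<open>Dominated convergence needs a sequence. The cap \<open>\<delta> / 2\<close>
    keeps it inside the range of the lower bound, and the cap 1 yields the dominating constant
    \<open>s\<^sup>2 + 4\<close>.\<close>
  define e where "e n = min 1 (\<delta> / 2) / real (Suc n)" for n
  have e0: "0 < e n" for n using \<delta>(1) by (simp add: e_def)
  have eM: "e n \<le> min 1 (\<delta> / 2)" for n
    using \<delta>(1) by (simp add: e_def field_simps min_def)
  have elim: "e \<longlonglongrightarrow> 0"
    unfolding e_def by (rule LIMSEQ_Suc[OF lim_const_over_n])
  have below: "k \<le> (LINT \<xi>|m. e n * P (e n) \<xi>)" for n
  proof -
    have "k / e n \<le> (LINT \<xi>|m. P (e n) \<xi>)"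
      using \<delta> e0[of n] eM[of n] by (intro \<delta>(2)) auto
    thus ?thesis using e0[of n] by (simp add: field_simps)
  qed
  have \<zeta>lim: "(\<lambda>n. \<zeta> (e n)) \<longlonglongrightarrow> p"
  proof -
    have "Complex s t = of_real s + \<i> * of_real t" for t by (simp add: complex_eq_iff)
    hence "(\<lambda>n. \<zeta> (e n)) = (\<lambda>n. cayley (of_real s + \<i> * of_real (e n)))" by (simp add: \<zeta>_def)
    also have "\<dots> \<longlonglongrightarrow> cayley (of_real s + \<i> * of_real 0)"
      unfolding cayley_def using cayley_real_denom[of s]
      by (intro tendsto_intros elim) auto
    finally show ?thesis by (simp add: p_def)
  qed
  have "emeasure m {p} \<noteq> 0"
  proof
    assume z: "emeasure m {p} = 0"
    have "(\<lambda>n. LINT \<xi>|m. e n * P (e n) \<xi>) \<longlonglongrightarrow> (LINT \<xi>|m. 0)"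
    proof (rule integral_dominated_convergence[where w = "\<lambda>_. s\<^sup>2 + 4"])
      show "integrable m (\<lambda>_. s\<^sup>2 + 4)" by (rule finite_measure.integrable_const[OF fin])
      show "(\<lambda>\<xi>. e n * P (e n) \<xi>) \<in> borel_measurable m" for n
        using int[OF e0[of n]] by (intro borel_measurable_times borel_measurable_const) auto
      have "{p} \<in> null_sets m" using z ps by (auto simp: null_sets_def m_def)
      hence ae: "AE \<xi> in m. \<xi> \<noteq> p" using AE_not_in by fastforce
      show "AE \<xi> in m. (\<lambda>n. e n * P (e n) \<xi>) \<longlonglongrightarrow> 0"
        using ae
      proof (rule AE_mp, intro AE_I2 impI)
        fix \<xi> assume "\<xi> \<noteq> p"
        hence "(\<lambda>n. e n * P (e n) \<xi>) \<longlonglongrightarrow> 0 * ((1 - (norm p)\<^sup>2) / (norm (\<xi> - p))\<^sup>2)"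
          unfolding P_def by (intro tendsto_intros elim \<zeta>lim) auto
        thus "(\<lambda>n. e n * P (e n) \<xi>) \<longlonglongrightarrow> 0" by simp
      qed
      show "AE \<xi> in m. norm (e n * P (e n) \<xi>) \<le> s\<^sup>2 + 4" for n
      proof (intro AE_I2)
        fix \<xi> assume "\<xi> \<in> space m"
        hence x: "norm \<xi> = 1" by (auto simp: m_def space_restrict_space)
        define w where "w = Complex s (e n)"
        have w: "0 < Im w" using e0 by (simp add: w_def)
        hence w0: "norm (w + \<i>) \<noteq> 0" by (auto simp: complex_eq_iff)
        have "0 \<le> P (e n) \<xi>"
          using \<zeta>1[OF e0[of n]] by (simp add: P_def abs_square_le_1)
        hence "norm (e n * P (e n) \<xi>) = e n * P (e n) \<xi>" using e0[of n] by simp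
        also have "\<dots> \<le> e n * (4 / (1 - (norm (\<zeta> (e n)))\<^sup>2))"
          using poisson_le[OF \<zeta>1[OF e0[of n]] x] e0[of n] unfolding P_def
          by (intro mult_left_mono) auto
        also have "1 - (norm (\<zeta> (e n)))\<^sup>2 = 4 * e n / (norm (w + \<i>))\<^sup>2"
          using one_minus_norm_cayley[OF w] by (simp add: \<zeta>_def w_def)
        also have "e n * (4 / \<dots>) = (norm (w + \<i>))\<^sup>2" using w0 e0[of n] by simp
        also have "\<dots> = s\<^sup>2 + (e n + 1)\<^sup>2" by (simp add: w_def cmod_power2)
        also have "\<dots> \<le> s\<^sup>2 + 2\<^sup>2" using eM[of n] e0[of n] by (intro add_left_mono power_mono) auto
        finally show "norm (e n * P (e n) \<xi>) \<le> s\<^sup>2 + 4" by simp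
      qed
    qed simp
    hence "k \<le> (LINT \<xi>|m. 0)" by (rule Lim_bounded2) (use below in auto)
    with k show False by simp
  qed
  hence "ennreal (Re (qform (\<mu> {p}) v)) \<noteq> 0"
    using emeasure_scalar_measure[OF nn ps] by (simp add: m_def)
  thus ?thesis by (simp add: p_def ennreal_eq_0_iff)
qed

text \<open>The density \<open>1 / (pi * (1 + t\<^sup>2))\<close> is positive at \<open>s\<close>,
  so \<open>\<nu> {s}\<close> can vanish only if the circle measure has no mass, in the direction
  \<open>v\<close>, at the image of \<open>s\<close>.\<close>

lemma spectral_measure_atom:
  assumes \<nu>: "spectral_measure B \<alpha> \<nu>" and k: "0 < k"
    and lower: "eventually (\<lambda>\<epsilon>. k / \<epsilon> \<le> Re (qform (Re_mat
        (matrix_inv (mat 1 - B (Complex s \<epsilon>) ** ctranspose \<alpha>) **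
        (mat 1 + B (Complex s \<epsilon>) ** ctranspose \<alpha>))) v)) (at_right 0)"
  shows "\<nu> {s} \<noteq> 0"
proof
  assume z: "\<nu> {s} = 0"
  obtain \<mu> where \<mu>: "clark_measure (disk_version B) \<alpha> \<mu>"
    and i': "\<forall>\<Omega>\<in>sets borel. has_mat_integral borel (cayley_pullback \<mu>)
            (\<lambda>t. indicator \<Omega> t * (1 / (pi * (1 + t\<^sup>2)))) (\<nu> \<Omega>)"
    using \<nu> unfolding spectral_measure_def by (elim exE conjE)
  have i: "has_mat_integral borel (cayley_pullback \<mu>)
            (\<lambda>t. indicator {s} t * (1 / (pi * (1 + t\<^sup>2)))) (\<nu> {s})"
    using i' by (rule bspec) simp
  define m where "m = scalar_measure borel (cayley_pullback \<mu>) v"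
  let ?h = "\<lambda>t. 1 / (pi * (1 + t\<^sup>2))"
  have "nonneg_mat_measure borel (cayley_pullback \<mu>)"
    using \<mu> by (intro nonneg_mat_measure_cayley_pullback) (simp add: clark_measure_def)
  hence "emeasure m {s} = ennreal (Re (qform (cayley_pullback \<mu> {s}) v))"
    by (simp add: m_def emeasure_scalar_measure)
  hence pos: "0 < measure m {s}"
    using clark_measure_atom[OF \<mu> k lower] by (simp add: measure_def cayley_pullback_def)
  have "0 = qform (\<nu> {s}) v" by (simp add: z qform_def)
  also have "\<dots> = of_real (LINT t|m. indicator {s} t * ?h t)"
    using i by (simp add: has_mat_integral_def m_def)
  also have "(LINT t|m. indicator {s} t * ?h t) = (LINT t|m. ?h s * indicator {s} t)"
    by (intro Bochner_Integration.integral_cong) (auto simp: indicator_def)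
  also have "\<dots> = ?h s * measure m {s}" by (simp add: m_def)
  finally have "complex_of_real (?h s * measure m {s}) = 0" by (rule sym)
  hence "?h s * measure m {s} = 0" by (simp only: of_real_eq_0_iff)
  moreover have "1 + s\<^sup>2 \<noteq> 0" by (smt (verit) zero_le_power2)
  ultimately show False using pos by simp
qed

section \<open>Solutions of the eigenvalue equation\<close>

text \<open>The derivative is carried as a separate function, and the equation holds on the whole
  line, so that values at both endpoints make sense.\<close>

definition solution :: "complex \<Rightarrow> (real \<Rightarrow> complex) \<Rightarrow> (real \<Rightarrow> complex) \<Rightarrow> bool" where
  "solution w f f' \<longleftrightarrow> (\<forall>x. (f has_vector_derivative f' x) (at x)) \<and>
     (\<forall>x. (f' has_vector_derivative - w * f x) (at x))"

text \<open>The gauge integral over the closed interval is the form in which the fundamental theorem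
  of calculus applies.\<close>

definition ip :: "real \<Rightarrow> (real \<Rightarrow> complex) \<Rightarrow> (real \<Rightarrow> complex) \<Rightarrow> complex" where
  "ip a f g = integral {- a..a} (\<lambda>x. f x * cnj (g x))"

definition boundary_trace :: "real \<Rightarrow> (real \<Rightarrow> complex) \<Rightarrow> (real \<Rightarrow> complex) \<Rightarrow> complex^4" where
  "boundary_trace a f f' = (\<chi> i. if i = 1 then f a else if i = 2 then f' a else if i = 3 then f (- a) else f' (- a))"

text \<open>The boundary term of Green's formula: the increment of
  \<open>f * cnj g' - f' * cnj g\<close> from \<open>- a\<close> to \<open>a\<close>, written in
  boundary values.\<close>

definition bform :: "complex^4 \<Rightarrow> complex^4 \<Rightarrow> complex" where
  "bform t u = t$1 * cnj (u$2) - t$2 * cnj (u$1) - t$3 * cnj (u$4) + t$4 * cnj (u$3)"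

lemma solution_lincomb:
  assumes "solution w f f'" "solution w g g'"
  shows "solution w (\<lambda>x. p * f x + q * g x) (\<lambda>x. p * f' x + q * g' x)"
  using assms unfolding solution_def
  by (auto intro!: derivative_eq_intros simp: algebra_simps)

lemma solution_continuous: "solution w f f' \<Longrightarrow> continuous_on S f"
  unfolding solution_def
  by (meson continuous_at_imp_continuous_on has_vector_derivative_continuous)

text \<open>In the derivative of \<open>f * cnj g' - f' * cnj g\<close> the products of first
  derivatives cancel, and the equations replace the second derivatives.\<close>

lemma lagrange_identity:
  assumes "0 < a" "solution w f f'" "solution z g g'"
  shows "(w - cnj z) * ip a f g = bform (boundary_trace a f f') (boundary_trace a g g')"
proof -
  have "((\<lambda>x. f x * cnj (g' x) - f' x * cnj (g x)) has_vector_derivative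
      (w - cnj z) * (f x * cnj (g x))) (at x within {- a..a})" for x
  proof -
    have 1: "(f has_vector_derivative f' x) (at x within {- a..a})"
        "(f' has_vector_derivative - w * f x) (at x within {- a..a})"
        "((\<lambda>x. cnj (g x)) has_vector_derivative cnj (g' x)) (at x within {- a..a})"
        "((\<lambda>x. cnj (g' x)) has_vector_derivative cnj (- z * g x)) (at x within {- a..a})"
      using assms(2,3) unfolding solution_def
      by (blast intro: has_vector_derivative_at_within bounded_linear.has_vector_derivative[OF bounded_linear_cnj])+
    show ?thesis
      by (rule has_vector_derivative_eq_rhs[OF has_vector_derivative_diff[OF
            has_vector_derivative_mult[OF 1(1,4)] has_vector_derivative_mult[OF 1(2,3)]]])
        (simp add: algebra_simps)
  qed
  hence "((\<lambda>x. (w - cnj z) * (f x * cnj (g x))) has_integral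
      (f a * cnj (g' a) - f' a * cnj (g a)) - (f (- a) * cnj (g' (- a)) - f' (- a) * cnj (g (- a)))) {- a..a}"
    using assms(1) by (intro fundamental_theorem_of_calculus) auto
  hence "integral {- a..a} (\<lambda>x. (w - cnj z) * (f x * cnj (g x))) =
      (f a * cnj (g' a) - f' a * cnj (g a)) - (f (- a) * cnj (g' (- a)) - f' (- a) * cnj (g (- a)))"
    by (rule integral_unique)
  thus ?thesis by (simp add: ip_def bform_def boundary_trace_def)
qed

text \<open>The basis functions are controlled only on the open interval. Continuous representatives
  on the closed interval make the integrand absolutely integrable, and the endpoints do not affect
  the integral.\<close>

lemma L2_inner_eq_ip:
  assumes "\<And>x. x \<in> {- a<..<a} \<Longrightarrow> f x = f' x" "\<And>x. x \<in> {- a<..<a} \<Longrightarrow> g x = g' x"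
    and "continuous_on {- a..a} f'" "continuous_on {- a..a} g'"
  shows "L2_inner a f g = ip a f' g'"
proof -
  have "(\<lambda>x. f' x * cnj (g' x)) absolutely_integrable_on {- a..a}"
    by (intro absolutely_integrable_continuous_real continuous_intros assms)
  hence i: "(\<lambda>x. f' x * cnj (g' x)) absolutely_integrable_on {- a<..<a}"
    by (rule set_integrable_subset) auto
  have "L2_inner a f g = (LINT x|L2_space a. f' x * cnj (g' x))"
    unfolding L2_inner_def using assms(1,2)
    by (intro Bochner_Integration.integral_cong) auto
  also have "\<dots> = (LINT x:{- a<..<a}|lebesgue. f' x * cnj (g' x))"
    unfolding set_lebesgue_integral_def by (rule integral_restrict_space) auto
  also have "\<dots> = integral {- a<..<a} (\<lambda>x. f' x * cnj (g' x))"
    by (rule set_lebesgue_integral_eq_integral(2)[OF i])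
  finally show ?thesis by (simp add: ip_def integral_open_interval_real)
qed

section \<open>Linearity, positivity and Bessel's inequality for the inner product\<close>

lemma ip_lincomb:
  assumes "continuous_on UNIV f" "continuous_on UNIV g" "continuous_on UNIV h"
  shows "ip a (\<lambda>x. p * f x + q * g x) h = p * ip a f h + q * ip a g h"
proof -
  have c: "continuous_on {- a..a} f" "continuous_on {- a..a} g" "continuous_on {- a..a} h"
    using assms continuous_on_subset by blast+
  have "(\<lambda>x. p * (f x * cnj (h x))) integrable_on {- a..a}"
      "(\<lambda>x. q * (g x * cnj (h x))) integrable_on {- a..a}"
    by (intro integrable_continuous_interval continuous_intros c)+
  hence "integral {- a..a} (\<lambda>x. p * (f x * cnj (h x)) + q * (g x * cnj (h x))) =
      integral {- a..a} (\<lambda>x. p * (f x * cnj (h x))) + integral {- a..a} (\<lambda>x. q * (g x * cnj (h x)))"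
    by (rule Henstock_Kurzweil_Integration.integral_add)
  thus ?thesis by (simp add: ip_def algebra_simps)
qed

lemma ip_cnj: "cnj (ip a f g) = ip a g f"
  by (simp add: ip_def Henstock_Kurzweil_Integration.integral_cnj mult.commute)

lemma ip_self_nonneg:
  assumes "continuous_on UNIV f"
  shows "0 \<le> Re (ip a f f)" "Im (ip a f f) = 0"
proof -
  have c: "continuous_on {- a..a} f" using assms continuous_on_subset by blast
  have "(\<lambda>x. f x * cnj (f x)) integrable_on {- a..a}"
    by (intro integrable_continuous_interval continuous_intros c)
  hence "integral {- a..a} (\<lambda>x. Re (f x * cnj (f x))) = Re (ip a f f)"
    unfolding ip_def using integral_linear[OF _ bounded_linear_Re] by (fastforce simp: o_def)
  moreover have "0 \<le> integral {- a..a} (\<lambda>x. Re (f x * cnj (f x)))"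
    by (intro Henstock_Kurzweil_Integration.integral_nonneg integrable_continuous_interval continuous_intros c) auto
  ultimately show "0 \<le> Re (ip a f f)" by simp
  have "cnj (ip a f f) = ip a f f" by (rule ip_cnj)
  thus "Im (ip a f f) = 0" by (simp add: complex_eq_iff)
qed

lemma bessel_inequality:
  assumes f: "continuous_on UNIV f" and g: "\<And>k :: 2. continuous_on UNIV (g k)"
    and orth: "\<And>k l. ip a (g k) (g l) = (if k = l then 1 else 0)"
  shows "(\<Sum>l\<in>UNIV. (norm (ip a f (g l)))\<^sup>2) \<le> Re (ip a f f)"
proof -
  define c where "c l = ip a f (g l)" for l
  define u where "u x = - c 1 * g 1 x + - c 2 * g 2 x" for x
  \<comment> \<open>\<open>h\<close> is \<open>f\<close> minus its orthogonal projection; the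
    factors 1 bring it into the shape of \<open>ip_lincomb\<close>.\<close>
  define h where "h x = 1 * f x + 1 * u x" for x
  have cu: "continuous_on UNIV u" unfolding u_def by (intro continuous_intros g)
  have ch: "continuous_on UNIV h" unfolding h_def by (intro continuous_intros f cu)
  have h_eq: "ip a h k = ip a f k - c 1 * ip a (g 1) k - c 2 * ip a (g 2) k"
    if "continuous_on UNIV k" for k
    unfolding h_def[abs_def] ip_lincomb[OF f cu that]
    unfolding u_def[abs_def] ip_lincomb[OF g g that] by simp
  have hg: "ip a h (g l) = 0" for l
    using exhaust_2[of l] by (auto simp: h_eq[OF g] orth c_def)
  have "ip a f h = cnj (ip a h f)" by (simp add: ip_cnj)
  also have "\<dots> = ip a f f - cnj (c 1) * c 1 - cnj (c 2) * c 2"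
    by (simp add: h_eq[OF f] ip_cnj c_def)
  finally have "ip a h h = ip a f f - cnj (c 1) * c 1 - cnj (c 2) * c 2"
    using h_eq[OF ch] hg by (metis (no_types, lifting) complex_cnj_zero diff_zero ip_cnj mult_zero_right)
  hence "Re (ip a h h) = Re (ip a f f) - (norm (c 1))\<^sup>2 - (norm (c 2))\<^sup>2"
    unfolding cmod_power2 by (simp add: power2_eq_square)
  with ip_self_nonneg(1)[OF ch, of a] show ?thesis by (simp add: sum_2 c_def)
qed

section \<open>The boundary form\<close>

lemma bform_skew: "bform u t = - cnj (bform t u)"
  by (simp add: bform_def algebra_simps)

text \<open>The vectors \<open>p\<close>, \<open>q\<close> are the boundary values of orthonormal bases of the two
  deficiency spaces; being orthogonal with nonzero squares for a nondegenerate form, they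
  span the four-dimensional space of boundary values.\<close>

lemma bform_expansion:
  fixes p q :: "2 \<Rightarrow> complex^4"
  assumes pp: "\<And>k l. bform (p k) (p l) = (if k = l then 2 * \<i> else 0)"
    and qq: "\<And>k l. bform (q k) (q l) = (if k = l then - 2 * \<i> else 0)"
    and pq: "\<And>k l. bform (p k) (q l) = 0"
  shows "2 * \<i> * t $ m = (\<Sum>l\<in>UNIV. bform t (p l) * p l $ m) - (\<Sum>l\<in>UNIV. bform t (q l) * q l $ m)"
proof -
  have qp: "bform (q k) (p l) = 0" for k l using pq[of l k] by (simp add: bform_skew[of "q k"])
  define R where "R = (\<chi> k::4. if k = 1 then p 1 else if k = 2 then p 2 else if k = 3 then q 1 else q 2)"
  \<comment> \<open>Multiplying a row by \<open>K\<close> pairs it with the rows of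
    \<open>R\<close>. Hence \<open>R ** K\<close> is the Gram matrix, which is diagonal, and
    \<open>L\<close> is its inverse.\<close>
  define K where "K = ((\<chi> (m::4) (k::4). if m = 1 then cnj (R$k$2) else if m = 2 then - cnj (R$k$1)
      else if m = 3 then - cnj (R$k$4) else cnj (R$k$3)) :: complex^4^4)"
  define L where "L = ((\<chi> k l. if k = l then (if k = 1 \<or> k = 2 then 1 / (2 * \<i>) else - 1 / (2 * \<i>)) else 0) :: complex^4^4)"
  have K: "(t v* K) $ k = bform t (R $ k)" for t k
    by (simp add: vector_matrix_mult_def K_def bform_def sum_4)
  have RK: "(R ** K) $ k $ l = bform (R $ k) (R $ l)" for k l
    unfolding K[symmetric] by (simp add: matrix_matrix_mult_def vector_matrix_mult_def mult.commute)
  have RR: "bform (R $ k) (R $ l) = (if k = l then if k = 1 \<or> k = 2 then 2 * \<i> else - 2 * \<i> else 0)" for k l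
    using exhaust_4[of k] exhaust_4[of l] by (auto simp: R_def pp qq pq qp)
  have XL: "(X ** L) $ k $ l = X $ k $ l * (L $ l $ l)" for X :: "complex^4^4" and k l
    by (simp add: matrix_matrix_mult_def L_def if_distrib[of "\<lambda>x. _ * x"] cong: if_cong)
  have vL: "(t v* L) $ l = t $ l * (L $ l $ l)" for t l
    using exhaust_4[of l] by (auto simp: vector_matrix_mult_def L_def sum_4)
  have "R ** K ** L = mat 1"
    unfolding vec_eq_iff by (simp add: XL RK RR) (simp add: L_def mat_def)
  hence "R ** (K ** L) = mat 1" by (simp add: matrix_mul_assoc)
  \<comment> \<open>For square matrices a one-sided inverse is two-sided; read in this order, the
    identity is the expansion of \<open>t\<close>.\<close>
  hence "K ** L ** R = mat 1" using matrix_left_right_inverse by blast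
  hence "t = ((t v* K) v* L) v* R" by (simp add: vector_matrix_mul_assoc)
  hence "t $ m = (((t v* K) v* L) v* R) $ m" by simp
  also have "\<dots> = (\<Sum>k\<in>UNIV. ((t v* K) v* L) $ k * R $ k $ m)"
    by (simp add: vector_matrix_mult_def mult.commute)
  also have "\<dots> = 1 / (2 * \<i>) * (bform t (p 1) * p 1 $ m + bform t (p 2) * p 2 $ m
      - bform t (q 1) * q 1 $ m - bform t (q 2) * q 2 $ m)"
    by (simp add: vL K sum_4) (simp add: L_def R_def divide_simps, simp add: algebra_simps)
  finally have "2 * \<i> * t $ m = 2 * \<i> * (1 / (2 * \<i>) * (bform t (p 1) * p 1 $ m + bform t (p 2) * p 2 $ m
      - bform t (q 1) * q 1 $ m - bform t (q 2) * q 2 $ m))"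
    by (rule arg_cong)
  also have "2 * \<i> * (1 / (2 * \<i>) * X) = X" for X by simp
  finally show ?thesis by (simp add: sum_2)
qed

text \<open>Parseval's identity for an indefinite form: expand the left argument of
  \<open>bform t t\<close>. By skewness each product \<open>bform t u * bform u t\<close> is minus a
  squared modulus, and the two deficiency spaces enter with opposite signs.\<close>

lemma krein_identity:
  fixes p q :: "2 \<Rightarrow> complex^4"
  assumes "\<And>k l. bform (p k) (p l) = (if k = l then 2 * \<i> else 0)"
    and "\<And>k l. bform (q k) (q l) = (if k = l then - 2 * \<i> else 0)"
    and "\<And>k l. bform (p k) (q l) = 0"
  shows "of_real ((\<Sum>l\<in>UNIV. (norm (bform t (p l)))\<^sup>2) - (\<Sum>l\<in>UNIV. (norm (bform t (q l)))\<^sup>2)) =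
    - 2 * \<i> * bform t t"
proof -
  have e: "2 * \<i> * t $ m = bform t (p 1) * p 1 $ m + bform t (p 2) * p 2 $ m
      - bform t (q 1) * q 1 $ m - bform t (q 2) * q 2 $ m" for m
    using bform_expansion[OF assms, where t = t and m = m] by (simp add: sum_2)
  have "2 * \<i> * bform t t = (2 * \<i> * t$1) * cnj (t$2) - (2 * \<i> * t$2) * cnj (t$1)
      - (2 * \<i> * t$3) * cnj (t$4) + (2 * \<i> * t$4) * cnj (t$3)"
    by (simp add: bform_def algebra_simps)
  also have "\<dots> = bform t (p 1) * bform (p 1) t + bform t (p 2) * bform (p 2) t
      - bform t (q 1) * bform (q 1) t - bform t (q 2) * bform (q 2) t"
    unfolding e by (simp add: bform_def[of _ t] algebra_simps)
  also have "\<dots> = - (bform t (p 1) * cnj (bform t (p 1)) + bform t (p 2) * cnj (bform t (p 2))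
      - bform t (q 1) * cnj (bform t (q 1)) - bform t (q 2) * cnj (bform t (q 2)))"
    by (simp add: bform_skew[of "p 1" t] bform_skew[of "p 2" t] bform_skew[of "q 1" t] bform_skew[of "q 2" t])
  finally show ?thesis by (simp add: sum_2 complex_norm_square del: of_real_power)
qed

section \<open>Entire dependence on the spectral parameter\<close>

text \<open>Cosine is even, so its series involves only powers of the square. The series avoids
  \<open>csqrt\<close>, which jumps across the negative axis, and so gives differentiability at
  every real point.\<close>

definition cos_sqrt :: "complex \<Rightarrow> complex" where
  "cos_sqrt z = (\<Sum>n. of_real (cos_coeff (2 * n)) * z ^ n)"

definition sinc_sqrt :: "complex \<Rightarrow> complex" where
  "sinc_sqrt z = (\<Sum>n. of_real (sin_coeff (2 * n + 1)) * z ^ n)"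

lemma cos_sqrt_sums: "(\<lambda>n. of_real (cos_coeff (2 * n)) * (p\<^sup>2) ^ n) sums cos (p :: complex)"
proof -
  have "(\<lambda>n. cos_coeff (2 * n) *\<^sub>R p ^ (2 * n)) sums cos p"
  proof (subst sums_mono_reindex[of "\<lambda>n. 2 * n" "\<lambda>n. cos_coeff n *\<^sub>R p ^ n"])
    fix n :: nat assume "n \<notin> range (\<lambda>n. 2 * n)"
    hence "odd n" by (auto elim!: evenE)
    thus "cos_coeff n *\<^sub>R p ^ n = 0" by (simp add: cos_coeff_def)
  qed (simp_all add: strict_mono_def cos_converges)
  thus ?thesis by (simp add: power_mult scaleR_conv_of_real)
qed

lemma sinc_sqrt_sums:
  assumes "p \<noteq> 0"
  shows "(\<lambda>n. of_real (sin_coeff (2 * n + 1)) * (p\<^sup>2) ^ n) sums (sin p / (p :: complex))"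
proof -
  have "(\<lambda>n. sin_coeff (2 * n + 1) *\<^sub>R p ^ (2 * n + 1)) sums sin p"
  proof (subst sums_mono_reindex[of "\<lambda>n. 2 * n + 1" "\<lambda>n. sin_coeff n *\<^sub>R p ^ n"])
    fix n :: nat assume "n \<notin> range (\<lambda>n. 2 * n + 1)"
    hence "even n" by (metis oddE rangeI)
    thus "sin_coeff n *\<^sub>R p ^ n = 0" by (simp add: sin_coeff_def)
  qed (simp_all add: strict_mono_def sin_converges)
  hence "(\<lambda>n. sin_coeff (2 * n + 1) *\<^sub>R p ^ (2 * n + 1) / p) sums (sin p / p)"
    by (rule sums_divide)
  thus ?thesis using assms by (simp add: power_mult scaleR_conv_of_real)
qed

lemma cos_sqrt_power2: "cos_sqrt (p\<^sup>2) = cos p"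
  unfolding cos_sqrt_def by (rule sums_unique[OF cos_sqrt_sums, symmetric])

lemma sinc_sqrt_power2: "p \<noteq> 0 \<Longrightarrow> sinc_sqrt (p\<^sup>2) = sin p / p"
  unfolding sinc_sqrt_def by (rule sums_unique[OF sinc_sqrt_sums, symmetric])

lemma sinc_sqrt_0: "sinc_sqrt 0 = 1"
  unfolding sinc_sqrt_def powser_zero by (simp add: sin_coeff_def)

lemma cos_sqrt_differentiable: "cos_sqrt field_differentiable (at z)"
proof -
  have "summable (\<lambda>n. complex_of_real (cos_coeff (2 * n)) * y ^ n)" for y
    using sums_summable[OF cos_sqrt_sums[of "csqrt y"]] by simp
  from termdiffs_strong_converges_everywhere[OF this] show ?thesis
    unfolding cos_sqrt_def[abs_def] field_differentiable_def by blast
qed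

lemma sinc_sqrt_differentiable: "sinc_sqrt field_differentiable (at z)"
proof -
  have "summable (\<lambda>n. complex_of_real (sin_coeff (2 * n + 1)) * y ^ n)" for y
  proof (cases "y = 0")
    case False
    thus ?thesis using sums_summable[OF sinc_sqrt_sums[of "csqrt y"]] by simp
  qed (simp add: powser_zero summable_zero_power)
  from termdiffs_strong_converges_everywhere[OF this] show ?thesis
    unfolding sinc_sqrt_def[abs_def] field_differentiable_def by blast
qed

text \<open>The solutions with data (1,0) and (0,1) at \<open>x = 0\<close>. Unlike the exponentials
  \<open>phi\<close>, which coincide at \<open>w = 0\<close>, they stay independent there and depend
  on \<open>w\<close> as entire functions.\<close>

definition cos_sol :: "complex \<Rightarrow> real \<Rightarrow> complex" where
  "cos_sol w x = cos (csqrt w * of_real x)"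

definition sin_sol :: "complex \<Rightarrow> real \<Rightarrow> complex" where
  "sin_sol w x = (if w = 0 then of_real x else sin (csqrt w * of_real x) / csqrt w)"

lemma cos_sol_entire: "cos_sol w x = cos_sqrt (w * of_real (x\<^sup>2))"
  using cos_sqrt_power2[of "csqrt w * of_real x"] by (simp add: cos_sol_def power_mult_distrib)

lemma sin_sol_entire: "sin_sol w x = of_real x * sinc_sqrt (w * of_real (x\<^sup>2))"
proof (cases "w = 0 \<or> x = 0")
  case False
  thus ?thesis using sinc_sqrt_power2[of "csqrt w * of_real x"]
    by (simp add: sin_sol_def power_mult_distrib)
qed (auto simp: sin_sol_def sinc_sqrt_0)

lemma cos_sol_differentiable: "(\<lambda>w. cos_sol w x) field_differentiable (at w)"
proof -
  have "(cos_sqrt \<circ> (\<lambda>w. w * of_real (x\<^sup>2))) field_differentiable (at w)"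
    by (intro field_differentiable_compose derivative_intros field_differentiable_mult cos_sqrt_differentiable)
  thus ?thesis by (simp add: cos_sol_entire o_def)
qed

lemma sin_sol_differentiable: "(\<lambda>w. sin_sol w x) field_differentiable (at w)"
proof -
  have "(sinc_sqrt \<circ> (\<lambda>w. w * of_real (x\<^sup>2))) field_differentiable (at w)"
    by (intro field_differentiable_compose derivative_intros field_differentiable_mult sinc_sqrt_differentiable)
  hence "(\<lambda>w. sinc_sqrt (w * of_real (x\<^sup>2))) field_differentiable (at w)" by (simp add: o_def)
  thus ?thesis unfolding sin_sol_entire by (intro field_differentiable_mult) auto
qed

text \<open>The difference quotient along the vertical ray converges to the derivative, so its norm
  is eventually below that of the derivative plus 1.\<close>

lemma differentiable_linear_bound:
  assumes "f field_differentiable (at (complex_of_real s))"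
  shows "\<exists>K. eventually (\<lambda>\<epsilon>. norm (f (Complex s \<epsilon>) - f (of_real s)) \<le> K * \<epsilon>) (at_right 0)"
proof -
  obtain d where "(f has_field_derivative d) (at (of_real s))"
    using assms unfolding field_differentiable_def by blast
  hence "((\<lambda>h. (f (of_real s + h) - f (of_real s)) / h) \<longlongrightarrow> d) (at 0)"
    by (simp add: DERIV_def)
  moreover have "filterlim (\<lambda>\<epsilon>. \<i> * complex_of_real \<epsilon>) (at 0) (at_right 0)"
    unfolding filterlim_at
    by (auto intro!: tendsto_eq_intros simp: eventually_at_filter)
  ultimately have "((\<lambda>\<epsilon>. (f (of_real s + \<i> * of_real \<epsilon>) - f (of_real s)) / (\<i> * of_real \<epsilon>)) \<longlongrightarrow> d) (at_right 0)"
    by (rule filterlim_compose)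
  from tendsto_norm[OF this]
  have "eventually (\<lambda>\<epsilon>. norm ((f (of_real s + \<i> * of_real \<epsilon>) - f (of_real s)) / (\<i> * of_real \<epsilon>)) < norm d + 1) (at_right 0)"
    by (rule order_tendstoD(2)) simp
  moreover have "eventually (\<lambda>\<epsilon>::real. 0 < \<epsilon>) (at_right 0)"
    by (rule eventually_at_right_less)
  ultimately have "eventually (\<lambda>\<epsilon>. norm (f (Complex s \<epsilon>) - f (of_real s)) \<le> (norm d + 1) * \<epsilon>) (at_right 0)"
  proof eventually_elim
    case (elim \<epsilon>)
    have "Complex s \<epsilon> = of_real s + \<i> * of_real \<epsilon>" by (simp add: complex_eq_iff)
    with elim show ?case by (simp add: norm_divide norm_mult divide_simps)
  qed
  thus ?thesis by blast
qed

lemma matrix_linear_bound: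
  fixes F :: "complex \<Rightarrow> complex^'n^'m"
  assumes "\<And>i j. (\<lambda>w. F w $ i $ j) field_differentiable (at (complex_of_real s))"
  shows "\<exists>K. eventually (\<lambda>\<epsilon>. norm (F (Complex s \<epsilon>) - F (of_real s)) \<le> K * \<epsilon>) (at_right 0)"
proof -
  have "\<forall>i. \<exists>K. \<forall>j. eventually (\<lambda>\<epsilon>. norm (F (Complex s \<epsilon>) $ i $ j - F (of_real s) $ i $ j) \<le> K j * \<epsilon>) (at_right 0)"
    by (intro allI choice differentiable_linear_bound[OF assms])
  hence "\<exists>K. \<forall>i j. eventually (\<lambda>\<epsilon>. norm (F (Complex s \<epsilon>) $ i $ j - F (of_real s) $ i $ j) \<le> K i j * \<epsilon>) (at_right 0)"
    by (rule choice)
  then obtain K where K: "\<forall>i j. eventually (\<lambda>\<epsilon>. norm (F (Complex s \<epsilon>) $ i $ j - F (of_real s) $ i $ j) \<le> K i j * \<epsilon>) (at_right 0)"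
    ..
  have l1: "norm x \<le> (\<Sum>i\<in>UNIV. norm (x $ i))" for x :: "'a::real_normed_vector^'k"
    by (simp add: norm_vec_def L2_set_le_sum)
  have "eventually (\<lambda>\<epsilon>. \<forall>i j. norm (F (Complex s \<epsilon>) $ i $ j - F (of_real s) $ i $ j) \<le> K i j * \<epsilon>) (at_right 0)"
    by (rule eventually_all_finite, rule eventually_all_finite) (use K in blast)
  hence "eventually (\<lambda>\<epsilon>. norm (F (Complex s \<epsilon>) - F (of_real s)) \<le> (\<Sum>i\<in>UNIV. \<Sum>j\<in>UNIV. K i j) * \<epsilon>) (at_right 0)"
  proof eventually_elim
    case (elim \<epsilon>)
    let ?X = "F (Complex s \<epsilon>) - F (of_real s)"
    have "norm ?X \<le> (\<Sum>i\<in>UNIV. norm (?X $ i))" by (rule l1)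
    also have "\<dots> \<le> (\<Sum>i\<in>UNIV. \<Sum>j\<in>UNIV. norm (?X $ i $ j))" by (intro sum_mono l1)
    also have "\<dots> \<le> (\<Sum>i\<in>UNIV. \<Sum>j\<in>UNIV. K i j * \<epsilon>)" by (intro sum_mono) (simp add: elim)
    finally show ?case by (simp add: sum_distrib_right)
  qed
  thus ?thesis by blast
qed

section \<open>The characteristic function in terms of boundary values\<close>

lemma phi_solution:
  "solution w (phi w k) (\<lambda>x. (if k = 1 then - 1 else 1) * \<i> * csqrt w * phi w k x)"
proof -
  define c where "c = (if k = 1 then - 1 else 1) * \<i> * csqrt w"
  have "c * c = - w"
    using power2_csqrt[of w] by (simp add: c_def power2_eq_square algebra_simps)
  moreover have "((\<lambda>x. exp (c * of_real x)) has_vector_derivative c * exp (c * of_real x)) (at x)" for x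
    by (rule has_vector_derivative_real_field) (auto intro!: derivative_eq_intros)
  ultimately have "solution w (\<lambda>x. exp (c * of_real x)) (\<lambda>x. c * exp (c * of_real x))"
    unfolding solution_def
    by (auto intro!: derivative_eq_intros simp: mult.assoc[symmetric])
  thus ?thesis by (simp add: c_def phi_def)
qed

lemma cos_sol_solution: "solution w (cos_sol w) (\<lambda>x. - w * sin_sol w x)"
  and sin_sol_solution: "solution w (sin_sol w) (cos_sol w)"
proof -
  have c: "(cos_sol w has_vector_derivative - w * sin_sol w x) (at x)" for x
  proof -
    have "csqrt w * csqrt w = w" using power2_csqrt[of w] by (simp add: power2_eq_square)
    hence e: "csqrt w = w / csqrt w" if "w \<noteq> 0" using that by (simp add: field_simps)
    have "((\<lambda>x. cos (csqrt w * of_real x)) has_vector_derivative - csqrt w * sin (csqrt w * of_real x)) (at x)"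
      by (rule has_vector_derivative_real_field) (auto intro!: derivative_eq_intros)
    moreover have "- csqrt w * sin (csqrt w * of_real x) = - w * sin_sol w x"
    proof (cases "w = 0")
      case False
      thus ?thesis by (subst e) (simp_all add: sin_sol_def)
    qed simp
    ultimately show ?thesis by (simp add: cos_sol_def[abs_def])
  qed
  have s: "(sin_sol w has_vector_derivative cos_sol w x) (at x)" for x
  proof (cases "w = 0")
    case True
    thus ?thesis by (auto simp: sin_sol_def[abs_def] cos_sol_def intro!: derivative_eq_intros)
  next
    case False
    hence "((\<lambda>x. sin (csqrt w * of_real x) / csqrt w) has_vector_derivative cos (csqrt w * of_real x)) (at x)"
      by (intro has_vector_derivative_real_field) (auto intro!: derivative_eq_intros)
    with False show ?thesis by (simp add: sin_sol_def[abs_def] cos_sol_def)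
  qed
  show "solution w (cos_sol w) (\<lambda>x. - w * sin_sol w x)" "solution w (sin_sol w) (cos_sol w)"
    unfolding solution_def using c s by (auto intro!: derivative_eq_intros)
qed

section \<open>General solutions and their boundary values\<close>

definition gen_sol :: "complex \<Rightarrow> complex^2 \<Rightarrow> real \<Rightarrow> complex" where
  "gen_sol w y x = y$1 * cos_sol w x + y$2 * sin_sol w x"

definition gen_sol' :: "complex \<Rightarrow> complex^2 \<Rightarrow> real \<Rightarrow> complex" where
  "gen_sol' w y x = y$1 * (- w * sin_sol w x) + y$2 * cos_sol w x"

definition trace_mat :: "real \<Rightarrow> complex \<Rightarrow> complex^4^2" where
  "trace_mat a w = (\<chi> j. if j = 1 then boundary_trace a (cos_sol w) (\<lambda>x. - w * sin_sol w x)
     else boundary_trace a (sin_sol w) (cos_sol w))"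

lemma gen_sol_solution: "solution w (gen_sol w y) (gen_sol' w y)"
  unfolding gen_sol_def[abs_def] gen_sol'_def[abs_def]
  by (intro solution_lincomb cos_sol_solution sin_sol_solution)

lemma trace_gen_sol: "boundary_trace a (gen_sol w y) (gen_sol' w y) = y v* trace_mat a w"
  by (simp add: vec_eq_iff forall_4 boundary_trace_def gen_sol_def gen_sol'_def vector_matrix_mult_def
      trace_mat_def sum_2 algebra_simps)

text \<open>The data at the endpoint \<open>a\<close> alone determine the solution: the Wronskian of
  the fundamental system is 1, and Cramer's rule recovers \<open>y\<close>.\<close>

lemma trace_mat_inj:
  assumes "y v* trace_mat a w = 0"
  shows "y = 0"
proof -
  let ?C = "cos_sol w a" and ?S = "sin_sol w a"
  have W: "?C * ?C + w * (?S * ?S) = 1"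
  proof (cases "w = 0")
    case False
    have "csqrt w * csqrt w = w" using power2_csqrt[of w] by (simp add: power2_eq_square)
    with False have "w * (?S * ?S) = sin (csqrt w * of_real a) * sin (csqrt w * of_real a)"
      by (simp add: sin_sol_def)
    thus ?thesis using sin_cos_squared_add2[of "csqrt w * of_real a"]
      by (simp add: cos_sol_def power2_eq_square)
  qed (simp add: cos_sol_def)
  have "boundary_trace a (gen_sol w y) (gen_sol' w y) = 0" using assms by (simp add: trace_gen_sol)
  hence e1: "y$1 * ?C + y$2 * ?S = 0" and e2: "y$2 * ?C - w * (y$1 * ?S) = 0"
    by (simp_all add: vec_eq_iff forall_4 boundary_trace_def gen_sol_def gen_sol'_def algebra_simps)
  have "y$1 = y$1 * (?C * ?C + w * (?S * ?S))" by (simp add: W)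
  also have "\<dots> = ?C * (y$1 * ?C + y$2 * ?S) - ?S * (y$2 * ?C - w * (y$1 * ?S))"
    by (simp add: algebra_simps)
  finally have 1: "y$1 = 0" by (simp add: e1 e2)
  have "y$2 = y$2 * (?C * ?C + w * (?S * ?S))" by (simp add: W)
  also have "\<dots> = w * ?S * (y$1 * ?C + y$2 * ?S) + ?C * (y$2 * ?C - w * (y$1 * ?S))"
    by (simp add: algebra_simps)
  finally have 2: "y$2 = 0" by (simp add: e1 e2)
  show ?thesis using 1 2 by (simp add: vec_eq_iff forall_2)
qed

lemma trace_mat_differentiable: "(\<lambda>w. trace_mat a w $ j $ m) field_differentiable (at z)"
proof -
  note d = cos_sol_differentiable sin_sol_differentiable
  have "(\<lambda>w. - w * sin_sol w x) field_differentiable (at z)" for x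
    by (intro field_differentiable_mult field_differentiable_minus d derivative_intros)
  with d show ?thesis
    using exhaust_2[of j] exhaust_4[of m] by (auto simp: trace_mat_def boundary_trace_def)
qed

text \<open>Encodes the pairings with \<open>p\<close> as a constant matrix, so that all dependence
  on \<open>w\<close> stays in \<open>trace_mat\<close>.\<close>

definition boundary_functional :: "(2 \<Rightarrow> complex^4) \<Rightarrow> complex^2^4" where
  "boundary_functional p = (\<chi> m k. if m = 1 then cnj (p k $ 2) else if m = 2 then - cnj (p k $ 1)
     else if m = 3 then - cnj (p k $ 4) else cnj (p k $ 3))"

lemma boundary_functional: "(t v* boundary_functional p) $ k = bform t (p k)"
  by (simp add: vector_matrix_mult_def boundary_functional_def bform_def sum_4)

text \<open>On the open interval \<open>\<psi> k\<close> is a combination of two exponentials; the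
  same combination on the whole line supplies the endpoint values that \<open>\<psi> k\<close>
  itself does not fix.\<close>

lemma deficiency_onb_solutions:
  assumes "0 < a" "deficiency_onb a z \<psi>"
  obtains g g' where "\<And>k. solution z (g k) (g' k)"
    and "\<And>k x. x \<in> {- a<..<a} \<Longrightarrow> \<psi> k x = g k x"
    and "\<And>k l. ip a (g k) (g l) = (if k = l then 1 else 0)"
proof -
  have "\<forall>k. \<exists>c. \<forall>x\<in>{- a<..<a}. \<psi> k x = (\<Sum>j\<in>UNIV. c j * phi z j x)"
    using assms(2) by (simp add: deficiency_onb_def)
  hence "\<exists>c. \<forall>k. \<forall>x\<in>{- a<..<a}. \<psi> k x = (\<Sum>j\<in>UNIV. c k j * phi z j x)"
    by (rule choice)
  then obtain c where c: "\<forall>k. \<forall>x\<in>{- a<..<a}. \<psi> k x = (\<Sum>j\<in>UNIV. c k j * phi z j x)" ..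
  define g where "g k x = c k 1 * phi z 1 x + c k 2 * phi z 2 x" for k x
  define g' where "g' k x = c k 1 * ((if (1::2) = 1 then - 1 else 1) * \<i> * csqrt z * phi z 1 x) +
      c k 2 * ((if (2::2) = 1 then - 1 else 1) * \<i> * csqrt z * phi z 2 x)" for k x
  have sol: "solution z (g k) (g' k)" for k
    unfolding g_def[abs_def] g'_def[abs_def] by (intro solution_lincomb phi_solution)
  have eq: "\<psi> k x = g k x" if "x \<in> {- a<..<a}" for k x
    using c that by (simp add: g_def sum_2)
  have "ip a (g k) (g l) = L2_inner a (\<psi> k) (\<psi> l)" for k l
    by (rule L2_inner_eq_ip[symmetric]) (auto simp: eq intro: solution_continuous[OF sol])
  hence "ip a (g k) (g l) = (if k = l then 1 else 0)" for k l
    using assms(2) by (simp add: deficiency_onb_def)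
  with sol eq show ?thesis by (rule that)
qed

lemma mat_matrix_mult: "(mat k ** X) $ i $ j = k * X $ i $ j" for X :: "'a::comm_semiring_1^'m^'n"
  by (simp add: matrix_matrix_mult_def mat_def if_distrib[of "\<lambda>x. x * _"] cong: if_cong)

lemma mat_mult_commute: "X ** mat k = mat k ** X" for X :: "complex^2^2"
  by (simp add: vec_eq_iff forall_2 matrix_matrix_mult_def mat_def sum_2 mult.commute)

text \<open>Row \<open>j\<close> holds the value and the derivative of \<open>phi w j\<close> at 0,
  that is, its coordinates in the fundamental system.\<close>

definition exp_coeffs :: "complex \<Rightarrow> complex^2^2" where
  "exp_coeffs w = (\<chi> j k. if k = 1 then 1 else (if j = 1 then - 1 else 1) * \<i> * csqrt w)"

lemma phi_eq_gen_sol: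
  assumes "w \<noteq> 0"
  shows "phi w j x = gen_sol w (exp_coeffs w $ j) x"
proof -
  have "phi w j x = cos_sol w x + (if j = 1 then - 1 else 1) * \<i> * sin (csqrt w * of_real x)"
    using exp_Euler[of "csqrt w * of_real x"] exp_Euler[of "- (csqrt w * of_real x)"]
    by (simp add: phi_def cos_sol_def mult.assoc)
  with assms show ?thesis by (simp add: gen_sol_def exp_coeffs_def sin_sol_def)
qed

lemma exp_coeffs_inj:
  assumes "w \<noteq> 0" "r v* exp_coeffs w = 0"
  shows "r = 0"
proof -
  have "r$1 + r$2 = 0" "\<i> * csqrt w * (r$2 - r$1) = 0"
    using assms(2) by (simp_all add: vec_eq_iff forall_2 vector_matrix_mult_def sum_2 exp_coeffs_def algebra_simps)
  hence "r$1 + r$2 = 0" "r$2 = r$1" using assms(1) by auto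
  thus ?thesis by (simp add: vec_eq_iff forall_2)
qed

text \<open>\<open>N1\<close> and \<open>N2\<close> pair boundary values with the bases at
  \<open>\<i>\<close> and \<open>- \<i>\<close>. By Green's formula these pairings are the inner
  products times \<open>w + \<i>\<close> and \<open>w - \<i>\<close>, and the ratio of the two
  factors is \<open>cayley w\<close>.\<close>

lemma livsic_boundary_values:
  assumes a: "0 < a" and onb: "deficiency_onb a \<i> (\<psi> \<i>)" "deficiency_onb a (- \<i>) (\<psi> (- \<i>))"
  obtains N1 N2 :: "complex^2^4"
  where "\<And>w. 0 < Im w \<Longrightarrow> trace_mat a w ** N1 ** livsic a \<psi> w = trace_mat a w ** N2"
    and "\<And>w. 0 \<le> Im w \<Longrightarrow> invertible (trace_mat a w ** N1)"
    and "\<And>w r. 0 < Im w \<Longrightarrow> norm (r v* livsic a \<psi> w) \<le> norm (cayley w) * norm r"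
proof -
  obtain g g' where g: "\<And>k. solution \<i> (g k) (g' k)"
    "\<And>k x. x \<in> {- a<..<a} \<Longrightarrow> \<psi> \<i> k x = g k x"
    "\<And>k l. ip a (g k) (g l) = (if k = l then 1 else 0)"
    using deficiency_onb_solutions[OF a onb(1)] by blast
  obtain h h' where h: "\<And>k. solution (- \<i>) (h k) (h' k)"
    "\<And>k x. x \<in> {- a<..<a} \<Longrightarrow> \<psi> (- \<i>) k x = h k x"
    "\<And>k l. ip a (h k) (h l) = (if k = l then 1 else 0)"
    using deficiency_onb_solutions[OF a onb(2)] by blast
  define p where "p k = boundary_trace a (g k) (g' k)" for k
  define q where "q k = boundary_trace a (h k) (h' k)" for k
  define c where "c w = trace_mat a w ** boundary_functional p" for w
  define e where "e w = trace_mat a w ** boundary_functional q" for w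
  have pp: "bform (p k) (p l) = (if k = l then 2 * \<i> else 0)" for k l
    unfolding p_def lagrange_identity[OF a g(1) g(1), symmetric] by (simp add: g(3))
  have qq: "bform (q k) (q l) = (if k = l then - 2 * \<i> else 0)" for k l
    unfolding q_def lagrange_identity[OF a h(1) h(1), symmetric] by (simp add: h(3))
  have pq: "bform (p k) (q l) = 0" for k l
    unfolding p_def q_def lagrange_identity[OF a g(1) h(1), symmetric] by simp
  have yc': "(y v* c w) $ l = bform (y v* trace_mat a w) (p l)"
    and ye': "(y v* e w) $ l = bform (y v* trace_mat a w) (q l)" for y w l
    by (simp_all add: c_def e_def vector_matrix_mul_assoc[symmetric] boundary_functional)
  have yc: "(y v* c w) $ l = (w + \<i>) * ip a (gen_sol w y) (g l)" for y w l
    unfolding yc' trace_gen_sol[symmetric] p_def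
      lagrange_identity[OF a gen_sol_solution g(1), symmetric] by simp
  have ye: "(y v* e w) $ l = (w - \<i>) * ip a (gen_sol w y) (h l)" for y w l
    unfolding ye' trace_gen_sol[symmetric] q_def
      lagrange_identity[OF a gen_sol_solution h(1), symmetric] by simp
  note cont = solution_continuous[OF gen_sol_solution]
  have krein: "(norm (y v* c w))\<^sup>2 - (norm (y v* e w))\<^sup>2 = 4 * Im w * Re (ip a (gen_sol w y) (gen_sol w y))"
    for y w
  proof -
    define t where "t = y v* trace_mat a w"
    let ?I = "ip a (gen_sol w y) (gen_sol w y)"
    have "complex_of_real ((norm (y v* c w))\<^sup>2 - (norm (y v* e w))\<^sup>2) = - 2 * \<i> * bform t t"
      unfolding norm_vec_squared yc' ye' t_def by (rule krein_identity[OF pp qq pq])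
    also have "bform t t = (w - cnj w) * ?I"
      unfolding t_def trace_gen_sol[symmetric] by (rule lagrange_identity[OF a gen_sol_solution gen_sol_solution, symmetric])
    also have "?I = of_real (Re ?I)"
      using ip_self_nonneg(2)[OF cont, where a = a] by (simp add: complex_eq_iff)
    also have "- 2 * \<i> * ((w - cnj w) * of_real (Re ?I)) = of_real (4 * Im w * Re ?I)"
      by (simp add: complex_eq_iff)
    finally show ?thesis by (simp only: of_real_eq_iff)
  qed
  \<comment> \<open>If \<open>y\<close> is killed by \<open>c w\<close>, Krein's identity with
    \<open>0 \<le> Im w\<close> forces \<open>e w\<close> to kill it too. The boundary value of the
    solution then pairs to zero with a basis, hence vanishes.\<close>
  have inv: "invertible (c w)" if w: "0 \<le> Im w" for w
  proof (rule invertible_vector_matrix)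
    fix y assume y: "y v* c w = 0"
    have "0 \<le> 4 * Im w * Re (ip a (gen_sol w y) (gen_sol w y))"
      using w ip_self_nonneg(1)[OF cont] by simp
    moreover have "(norm (y v* c w))\<^sup>2 = 0" using y by simp
    ultimately have "(norm (y v* e w))\<^sup>2 \<le> 0" using krein[of y w] by linarith
    hence "y v* e w = 0" by simp
    hence "bform (y v* trace_mat a w) (p l) = 0" "bform (y v* trace_mat a w) (q l) = 0" for l
      using y unfolding yc'[symmetric] ye'[symmetric] by simp_all
    hence "2 * \<i> * (y v* trace_mat a w) $ m = 0" for m
      unfolding bform_expansion[OF pp qq pq] by simp
    hence "y v* trace_mat a w = 0" by (simp add: vec_eq_iff)
    thus "y = 0" by (rule trace_mat_inj)
  qed
  have ceB: "c w ** livsic a \<psi> w = e w" if w: "0 < Im w" for w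
  proof -
    let ?P = "exp_coeffs w" and ?A = "A_mat a \<psi> w"
    have w0: "w \<noteq> 0" "w + \<i> \<noteq> 0" using w by (auto simp: complex_eq_iff)
    have phi: "phi w j = gen_sol w (?P $ j)" for j
      using phi_eq_gen_sol[OF w0(1)] by auto
    have row: "(X ** Y) $ j = X $ j v* Y" for X :: "complex^2^2" and Y :: "complex^2^2" and j
      by (simp add: vec_eq_iff matrix_matrix_mult_def vector_matrix_mult_def mult.commute)
    have A1: "?A \<i> $ j $ l = ip a (gen_sol w (?P $ j)) (g l)" for j l
      unfolding A_mat_def phi
      by (simp, rule L2_inner_eq_ip) (auto simp: g(2) intro: cont solution_continuous[OF g(1)])
    have A2: "?A (- \<i>) $ j $ l = ip a (gen_sol w (?P $ j)) (h l)" for j l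
      unfolding A_mat_def phi
      by (simp, rule L2_inner_eq_ip) (auto simp: h(2) intro: cont solution_continuous[OF h(1)])
    \<comment> \<open>\<open>?P\<close> passes from the fundamental system to the exponentials that
      define \<open>A_mat\<close>; the scalar factor comes from Green's formula.\<close>
    have Pc: "?P ** c w = mat (w + \<i>) ** ?A \<i>"
      by (simp add: vec_eq_iff mat_matrix_mult A1) (simp add: row yc)
    have Pe: "?P ** e w = mat (w - \<i>) ** ?A (- \<i>)"
      by (simp add: vec_eq_iff mat_matrix_mult A2) (simp add: row ye)
    have iP: "invertible ?P" by (rule invertible_vector_matrix) (rule exp_coeffs_inj[OF w0(1)])
    have iA: "invertible (?A \<i>)"
    proof (rule invertible_vector_matrix)
      fix r assume r: "r v* ?A \<i> = 0"
      have "(r v* ?P) v* c w = (r v* ?A \<i>) v* mat (w + \<i>)"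
        by (simp add: vector_matrix_mul_assoc Pc mat_mult_commute)
      hence "(r v* ?P) v* c w = 0" by (simp add: r)
      hence "((r v* ?P) v* c w) v* matrix_inv (c w) = 0" by simp
      hence "r v* ?P = 0"
        using inv[of w] w by (simp add: vector_matrix_mul_assoc matrix_inv_right_inverse flip: matrix_mul_assoc)
      thus "r = 0" by (rule exp_coeffs_inj[OF w0(1)])
    qed
    have "?P ** (c w ** livsic a \<psi> w) =
        mat (w + \<i>) ** (?A \<i> ** mat (cayley w)) ** matrix_inv (?A \<i>) ** ?A (- \<i>)"
      by (simp add: matrix_mul_assoc Pc livsic_def)
    also have "\<dots> = mat (w + \<i>) ** (mat (cayley w) ** ((?A \<i> ** matrix_inv (?A \<i>)) ** ?A (- \<i>)))"
      by (simp only: mat_mult_commute[of "?A \<i>"] matrix_mul_assoc)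
    also have "\<dots> = mat (w - \<i>) ** ?A (- \<i>)"
      using w0 by (simp add: matrix_inv_right_inverse[OF iA] vec_eq_iff mat_matrix_mult cayley_def)
    also have "\<dots> = ?P ** e w" by (rule Pe[symmetric])
    finally have "matrix_inv ?P ** (?P ** (c w ** livsic a \<psi> w)) = matrix_inv ?P ** (?P ** e w)"
      by simp
    thus ?thesis by (simp add: matrix_mul_assoc matrix_inv_left_inverse[OF iP])
  qed
  \<comment> \<open>Write \<open>r\<close> as \<open>y v* c w\<close>, so that
    \<open>r v* livsic a \<psi> w\<close> is \<open>y v* e w\<close>. Bessel's inequality bounds
    \<open>norm r\<close> by the norm of the solution, and Krein's identity expresses that norm
    through the two rows.\<close>
  have schwarz: "norm (r v* livsic a \<psi> w) \<le> norm (cayley w) * norm r" if w: "0 < Im w" for w r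
  proof -
    define y where "y = r v* matrix_inv (c w)"
    let ?I = "Re (ip a (gen_sol w y) (gen_sol w y))"
    have r: "y v* c w = r"
      using inv[of w] w by (simp add: y_def vector_matrix_mul_assoc matrix_inv_left_inverse)
    have rB: "y v* e w = r v* livsic a \<psi> w"
      by (simp add: ceB[OF w, symmetric] vector_matrix_mul_assoc[symmetric] r)
    have w0: "norm (w + \<i>) \<noteq> 0" using w by (auto simp: complex_eq_iff)
    have "(norm r)\<^sup>2 = (norm (w + \<i>))\<^sup>2 * (\<Sum>l\<in>UNIV. (norm (ip a (gen_sol w y) (g l)))\<^sup>2)"
      unfolding r[symmetric] norm_vec_squared yc by (simp add: norm_mult power_mult_distrib sum_distrib_left)
    also have "\<dots> \<le> (norm (w + \<i>))\<^sup>2 * ?I"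
      by (intro mult_left_mono bessel_inequality cont solution_continuous[OF g(1)] g(3)) auto
    finally have "4 * Im w / (norm (w + \<i>))\<^sup>2 * (norm r)\<^sup>2 \<le> 4 * Im w * ?I"
      using w w0 by (simp add: divide_simps) (simp add: mult.commute)
    also have "\<dots> = (norm r)\<^sup>2 - (norm (r v* livsic a \<psi> w))\<^sup>2"
      using krein[of y w] by (simp add: r rB)
    finally have "(1 - (norm (cayley w))\<^sup>2) * (norm r)\<^sup>2 \<le> (norm r)\<^sup>2 - (norm (r v* livsic a \<psi> w))\<^sup>2"
      by (simp only: one_minus_norm_cayley[OF w])
    hence "(norm (r v* livsic a \<psi> w))\<^sup>2 \<le> (norm (cayley w) * norm r)\<^sup>2"
      by (simp add: power_mult_distrib algebra_simps)
    thus ?thesis by (rule power2_le_imp_le) simp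
  qed
  show ?thesis
    by (rule that[of "boundary_functional p" "boundary_functional q"])
      (use ceB inv schwarz in \<open>simp_all add: c_def e_def\<close>)
qed

section \<open>The point mass\<close>

lemma bounded_bilinear_matrix_mult:
  "bounded_bilinear ((**) :: complex^'n^'m \<Rightarrow> complex^'p^'n \<Rightarrow> complex^'p^'m)"
proof -
  have "linear (\<lambda>y. (x :: complex^'n^'m) ** (y :: complex^'p^'n))" for x
    by (rule linearI) (simp_all add: vec_eq_iff matrix_matrix_mult_def sum.distrib distrib_left scaleR_sum_right)
  moreover have "linear (\<lambda>x. (x :: complex^'n^'m) ** (y :: complex^'p^'n))" for y
    by (rule linearI) (simp_all add: vec_eq_iff matrix_matrix_mult_def sum.distrib distrib_right scaleR_sum_right)
  ultimately have "bilinear ((**) :: complex^'n^'m \<Rightarrow> complex^'p^'n \<Rightarrow> complex^'p^'m)"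
    unfolding bilinear_def by blast
  thus ?thesis by (rule bilinear_conv_bounded_bilinear[THEN iffD1])
qed

lemma bounded_bilinear_matrix_vector_mult:
  "bounded_bilinear ((*v) :: complex^'n^'m \<Rightarrow> complex^'n \<Rightarrow> complex^'m)"
proof -
  have "linear (\<lambda>y. (x :: complex^'n^'m) *v y)" for x
    by (rule linearI) (simp_all add: vec_eq_iff matrix_vector_mult_def sum.distrib distrib_left scaleR_sum_right)
  moreover have "linear (\<lambda>x. (x :: complex^'n^'m) *v y)" for y
    by (rule linearI) (simp_all add: vec_eq_iff matrix_vector_mult_def sum.distrib distrib_right scaleR_sum_right)
  ultimately have "bilinear ((*v) :: complex^'n^'m \<Rightarrow> complex^'n \<Rightarrow> complex^'m)"
    unfolding bilinear_def by blast
  thus ?thesis by (rule bilinear_conv_bounded_bilinear[THEN iffD1])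
qed

text \<open>Insert \<open>matrix_inv F ** F\<close> between the conjugate row of \<open>v\<close>
  and \<open>v\<close>, then apply Cauchy-Schwarz.\<close>

lemma norm_squared_le_row:
  fixes F :: "complex^2^2"
  assumes "invertible F"
  shows "(norm v)\<^sup>2 \<le> norm ((\<chi> i. cnj (v $ i)) v* matrix_inv F) * norm (F *v v)" (is "_ \<le> norm ?r * _")
proof -
  have r: "?r v* F = (\<chi> i. cnj (v $ i))"
    by (simp add: vector_matrix_mul_assoc matrix_inv_left_inverse assms)
  have "complex_of_real ((norm v)\<^sup>2) = (\<Sum>i\<in>UNIV. (?r v* F) $ i * v $ i)"
    unfolding r by (simp add: norm_vec_squared complex_norm_square mult.commute del: of_real_power)
  also have "\<dots> = (\<Sum>i\<in>UNIV. ?r $ i * (F *v v) $ i)" by (rule vector_matrix_dot)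
  finally have "norm (complex_of_real ((norm v)\<^sup>2)) = norm (\<Sum>i\<in>UNIV. ?r $ i * (F *v v) $ i)"
    by (rule arg_cong)
  hence "(norm v)\<^sup>2 = norm (\<Sum>i\<in>UNIV. ?r $ i * (F *v v) $ i)"
    by (simp only: norm_of_real abs_power2)
  also have "\<dots> \<le> (\<Sum>i\<in>UNIV. \<bar>norm (?r $ i)\<bar> * \<bar>norm ((F *v v) $ i)\<bar>)"
    by (rule order_trans[OF norm_sum]) (simp add: norm_mult)
  also have "\<dots> \<le> norm ?r * norm (F *v v)"
    unfolding norm_vec_def by (rule L2_set_mult_ineq)
  finally show ?thesis .
qed

lemma nontangential_limit_vertical:
  assumes "nontangential_limit F s M"
  shows "((\<lambda>\<epsilon>. F (Complex s \<epsilon>)) \<longlongrightarrow> M) (at_right 0)"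
proof -
  \<comment> \<open>Any aperture above 1 serves: on the vertical ray the distance to
    \<open>s\<close> equals the imaginary part.\<close>
  have "(F \<longlongrightarrow> M) (at (of_real s) within {w. 0 < Im w \<and> norm (w - of_real s) < 2 * Im w})"
    using assms by (simp add: nontangential_limit_def)
  moreover have "filterlim (Complex s) (at (of_real s) within {w. 0 < Im w \<and> norm (w - of_real s) < 2 * Im w}) (at_right 0)"
    unfolding filterlim_at
  proof
    have "((\<lambda>\<epsilon>. of_real s + \<i> * of_real \<epsilon>) \<longlongrightarrow> complex_of_real s) (at_right 0)"
      by (auto intro!: tendsto_eq_intros)
    moreover have "of_real s + \<i> * of_real \<epsilon> = Complex s \<epsilon>" for \<epsilon> by (simp add: complex_eq_iff)
    ultimately show "(Complex s \<longlongrightarrow> complex_of_real s) (at_right 0)" by simp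
    have "norm (Complex s \<epsilon> - of_real s) = \<bar>\<epsilon>\<bar>" for \<epsilon> by (simp add: cmod_def)
    thus "\<forall>\<^sub>F \<epsilon> in at_right 0. Complex s \<epsilon> \<in> {w. 0 < Im w \<and> norm (w - of_real s) < 2 * Im w} \<and>
        Complex s \<epsilon> \<noteq> complex_of_real s"
      by (auto simp: eventually_at_filter complex_eq_iff)
  qed
  ultimately show ?thesis by (rule filterlim_compose)
qed

theorem theorem18:
  fixes a s :: real
    and \<alpha> M :: "complex^2^2"
    and \<psi> :: "complex \<Rightarrow> 2 \<Rightarrow> real \<Rightarrow> complex"
    and \<nu> :: "real set \<Rightarrow> complex^2^2"
  assumes "0 < a"
    and "unitary_mat \<alpha>"
    and "deficiency_onb a \<i> (\<psi> \<i>)"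
    and "deficiency_onb a (- \<i>) (\<psi> (- \<i>))"
    and "spectral_measure (livsic a \<psi>) \<alpha> \<nu>"
    and "nontangential_limit (\<lambda>w. mat 1 - livsic a \<psi> w ** ctranspose \<alpha>) s M"
    and "\<exists>v. v \<noteq> 0 \<and> M *v v = 0"
  shows "\<nu> {s} \<noteq> 0"
proof -
  obtain v where v: "v \<noteq> 0" "M *v v = 0" using assms(7) by blast
  define G where "G w = livsic a \<psi> w ** ctranspose \<alpha>" for w
  define F where "F w = mat 1 - G w" for w
  define T where "T = trace_mat a"
  obtain N1 N2 where N: "\<And>w. 0 < Im w \<Longrightarrow> T w ** N1 ** livsic a \<psi> w = T w ** N2"
    and inv: "\<And>w. 0 \<le> Im w \<Longrightarrow> invertible (T w ** N1)"
    and schwarz: "\<And>w r. 0 < Im w \<Longrightarrow> norm (r v* livsic a \<psi> w) \<le> norm (cayley w) * norm r"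
    unfolding T_def using livsic_boundary_values[OF assms(1,3,4)] by blast
  \<comment> \<open>Multiplying \<open>F w\<close> by \<open>T w ** N1\<close> clears the
    denominator of the characteristic function; the result is \<open>T w\<close> times the constant
    matrix \<open>X\<close>.\<close>
  define X where "X = N1 - N2 ** ctranspose \<alpha>"
  have TF: "T w ** N1 ** F w = T w ** X" if "0 < Im w" for w
  proof -
    have "T w ** N1 ** F w = T w ** N1 - (T w ** N1 ** livsic a \<psi> w) ** ctranspose \<alpha>"
      by (simp add: F_def G_def bounded_bilinear.diff_right[OF bounded_bilinear_matrix_mult] matrix_mul_assoc)
    also have "\<dots> = T w ** X"
      by (simp add: N that X_def bounded_bilinear.diff_right[OF bounded_bilinear_matrix_mult] matrix_mul_assoc)
    finally show ?thesis .
  qed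
  obtain K where K: "eventually (\<lambda>\<epsilon>. norm (T (Complex s \<epsilon>) - T (of_real s)) \<le> K * \<epsilon>) (at_right 0)"
    unfolding T_def using matrix_linear_bound[of "trace_mat a" s, OF trace_mat_differentiable] by blast
  have Kpos: "eventually (\<lambda>\<epsilon>. norm (T (Complex s \<epsilon>) - T (of_real s)) \<le> \<bar>K\<bar> * \<epsilon>) (at_right 0)"
    using K eventually_at_right_less[of 0]
  proof eventually_elim
    case (elim \<epsilon>)
    moreover have "K * \<epsilon> \<le> \<bar>K\<bar> * \<epsilon>" using elim by (intro mult_right_mono) auto
    ultimately show ?case by linarith
  qed
  have Flim: "((\<lambda>\<epsilon>. F (Complex s \<epsilon>)) \<longlongrightarrow> M) (at_right 0)"
    using nontangential_limit_vertical[OF assms(6)] by (simp add: F_def G_def)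
  have Tlim: "((\<lambda>\<epsilon>. T (Complex s \<epsilon>)) \<longlongrightarrow> T (of_real s)) (at_right 0)"
  proof (rule LIM_zero_cancel, rule Lim_null_comparison[OF K])
    show "((\<lambda>\<epsilon>. K * \<epsilon>) \<longlongrightarrow> 0) (at_right 0)" by (auto intro!: tendsto_eq_intros)
  qed
  note tendsto_mm = bounded_bilinear.tendsto[OF bounded_bilinear_matrix_mult]
  note tendsto_mv = bounded_bilinear.tendsto[OF bounded_bilinear_matrix_vector_mult]
  \<comment> \<open>Carries the relation to the real point, where \<open>M *v v = 0\<close> makes
    \<open>T (of_real s)\<close> annihilate \<open>X *v v\<close>.\<close>
  have "T (of_real s) ** N1 ** M = T (of_real s) ** X"
  proof (rule tendsto_unique[OF trivial_limit_at_right_real])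
    show "((\<lambda>\<epsilon>. T (Complex s \<epsilon>) ** X) \<longlongrightarrow> T (of_real s) ** X) (at_right 0)"
      by (intro tendsto_mm Tlim tendsto_const)
    have "((\<lambda>\<epsilon>. T (Complex s \<epsilon>) ** N1 ** F (Complex s \<epsilon>)) \<longlongrightarrow> T (of_real s) ** N1 ** M) (at_right 0)"
      by (intro tendsto_mm Tlim Flim tendsto_const)
    thus "((\<lambda>\<epsilon>. T (Complex s \<epsilon>) ** X) \<longlongrightarrow> T (of_real s) ** N1 ** M) (at_right 0)"
      by (rule Lim_transform_eventually)
        (auto intro!: eventually_mono[OF eventually_at_right_less[of 0]] TF)
  qed
  hence "T (of_real s) *v (X *v v) = T (of_real s) ** N1 *v (M *v v)"
    by (simp add: matrix_vector_mul_assoc)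
  hence Ts: "T (of_real s) *v (X *v v) = 0" by (simp add: v)
  obtain L where L: "0 < L" "\<And>(A :: complex^4^2) x. norm (A *v x) \<le> norm A * norm x * L"
    using bounded_bilinear.pos_bounded[OF bounded_bilinear_matrix_vector_mult] by blast
  obtain L1 where L1: "0 < L1" "\<And>(A :: complex^2^4) x. norm (A *v x) \<le> norm A * norm x * L1"
    using bounded_bilinear.pos_bounded[OF bounded_bilinear_matrix_vector_mult] by blast
  obtain L2 where L2: "0 < L2" "\<And>(A :: complex^2^2) x. norm (A *v x) \<le> norm A * norm x * L2"
    using bounded_bilinear.pos_bounded[OF bounded_bilinear_matrix_vector_mult] by blast
  define c where "c = T (of_real s) ** N1"
  have ic: "invertible c" unfolding c_def by (rule inv) simp
  define u where "u \<epsilon> = F (Complex s \<epsilon>) *v v" for \<epsilon>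
  \<comment> \<open>Collects the linear rate of \<open>u\<close> derived below; the added 1 keeps it
    positive for the later division.\<close>
  define K' where "K' = norm (matrix_inv c) * (\<bar>K\<bar> * (norm (X *v v) + norm N1 * 1 * L1) * L) * L2 + 1"
  have K': "0 < K'"
    using L(1) L1(1) L2(1) unfolding K'_def by (intro add_nonneg_pos mult_nonneg_nonneg add_nonneg_nonneg) auto
  \<comment> \<open>From the convergence to 0 only the crude bound
    \<open>norm (u \<epsilon>) < 1\<close> is kept; it is then improved to a linear rate.\<close>
  have "(u \<longlongrightarrow> M *v v) (at_right 0)"
    unfolding u_def[abs_def] by (intro tendsto_mv Flim tendsto_const)
  hence "((\<lambda>\<epsilon>. norm (u \<epsilon>)) \<longlongrightarrow> 0) (at_right 0)" using v by (simp add: tendsto_norm_zero)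
  hence "eventually (\<lambda>\<epsilon>. norm (u \<epsilon>) < 1) (at_right 0)" by (rule order_tendstoD(2)) simp
  moreover have pos: "eventually (\<lambda>\<epsilon>::real. 0 < \<epsilon>) (at_right 0)" by (rule eventually_at_right_less)
  ultimately have u: "eventually (\<lambda>\<epsilon>. norm (u \<epsilon>) \<le> K' * \<epsilon>) (at_right 0)"
    using Kpos
  proof eventually_elim
    case (elim \<epsilon>)
    define w where "w = Complex s \<epsilon>"
    \<comment> \<open>The denominator is frozen at \<open>s\<close>. Since
      \<open>T (of_real s)\<close> annihilates \<open>X *v v\<close>, every remaining term carries
      the difference of \<open>T\<close>, which is of order \<open>\<epsilon>\<close>.\<close>
    have "c *v u \<epsilon> = T w ** N1 *v u \<epsilon> - (T w - T (of_real s)) *v (N1 *v u \<epsilon>)"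
      by (simp add: c_def matrix_vector_mult_diff_rdistrib flip: matrix_vector_mul_assoc)
    also have "T w ** N1 *v u \<epsilon> = T w *v (X *v v)"
      using TF[of w] elim by (simp add: u_def w_def matrix_vector_mul_assoc)
    also have "\<dots> = (T w - T (of_real s)) *v (X *v v)"
      by (simp add: matrix_vector_mult_diff_rdistrib Ts)
    also have "\<dots> - (T w - T (of_real s)) *v (N1 *v u \<epsilon>) = (T w - T (of_real s)) *v (X *v v - N1 *v u \<epsilon>)"
      by (simp add: matrix_vector_mult_diff_distrib)
    finally have "norm (c *v u \<epsilon>) \<le> norm (T w - T (of_real s)) * norm (X *v v - N1 *v u \<epsilon>) * L"
      using L(2) by simp
    also have "\<dots> \<le> \<bar>K\<bar> * \<epsilon> * (norm (X *v v) + norm N1 * 1 * L1) * L"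
    proof (intro mult_right_mono mult_mono)
      have "norm (X *v v - N1 *v u \<epsilon>) \<le> norm (X *v v) + norm (N1 *v u \<epsilon>)" by (rule norm_triangle_ineq4)
      also have "norm (N1 *v u \<epsilon>) \<le> norm N1 * norm (u \<epsilon>) * L1" by (rule L1(2))
      also have "\<dots> \<le> norm N1 * 1 * L1" using elim L1(1) by (intro mult_right_mono mult_left_mono) auto
      finally show "norm (X *v v - N1 *v u \<epsilon>) \<le> norm (X *v v) + norm N1 * 1 * L1" by simp
    qed (use elim L(1) L1(1) in \<open>auto simp: w_def\<close>)
    finally have cu: "norm (c *v u \<epsilon>) \<le> \<bar>K\<bar> * \<epsilon> * (norm (X *v v) + norm N1 * 1 * L1) * L" .
    have "u \<epsilon> = matrix_inv c *v (c *v u \<epsilon>)"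
      by (simp add: matrix_vector_mul_assoc matrix_inv_left_inverse[OF ic])
    hence "norm (u \<epsilon>) \<le> norm (matrix_inv c) * norm (c *v u \<epsilon>) * L2" by (metis L2(2))
    also have "\<dots> \<le> norm (matrix_inv c) * (\<bar>K\<bar> * \<epsilon> * (norm (X *v v) + norm N1 * 1 * L1) * L) * L2"
      using cu L2(1) by (intro mult_right_mono mult_left_mono) auto
    also have "\<dots> = (K' - 1) * \<epsilon>" by (simp add: K'_def)
    also have "\<dots> \<le> K' * \<epsilon>" using elim by (intro mult_right_mono) auto
    finally show ?case .
  qed
  \<comment> \<open>The square of \<open>norm r\<close> is at least
    \<open>(norm v)^4 / (K'\<^sup>2 * \<epsilon>\<^sup>2)\<close>, and
    \<open>1 - (norm (cayley w))\<^sup>2\<close> is at least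
    \<open>4 * \<epsilon> / (s\<^sup>2 + 4)\<close> for \<open>\<epsilon> < 1\<close>; their product
    is \<open>k / \<epsilon>\<close>.\<close>
  define k where "k = 4 * (norm v)^4 / ((s\<^sup>2 + 4) * K'\<^sup>2)"
  have s4: "0 < s\<^sup>2 + 4" by (smt (verit) zero_le_power2)
  have k: "0 < k" using v(1) K' s4 by (simp add: k_def)
  have "eventually (\<lambda>\<epsilon>::real. \<epsilon> < 1) (at_right 0)"
    by (rule eventually_at_right_real[THEN eventually_mono, of 0 1]) auto
  with u pos have "eventually (\<lambda>\<epsilon>. k / \<epsilon> \<le> Re (qform (Re_mat
      (matrix_inv (mat 1 - livsic a \<psi> (Complex s \<epsilon>) ** ctranspose \<alpha>) **
      (mat 1 + livsic a \<psi> (Complex s \<epsilon>) ** ctranspose \<alpha>))) v)) (at_right 0)"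
  proof eventually_elim
    case (elim \<epsilon>)
    define w where "w = Complex s \<epsilon>"
    have w: "0 < Im w" using elim by (simp add: w_def)
    have w0: "norm (w + \<i>) \<noteq> 0" using w by (auto simp: complex_eq_iff)
    have rG: "norm (r v* G w) \<le> norm (cayley w) * norm r" for r
      using schwarz[OF w, of r] norm_unitary[OF unitary_ctranspose[OF assms(2)]]
      by (simp add: G_def vector_matrix_mul_assoc[symmetric])
    have c1: "0 < 1 - (norm (cayley w))\<^sup>2"
      using w w0 by (simp add: one_minus_norm_cayley)
    hence c1': "norm (cayley w) < 1" by (simp add: abs_square_less_1)
    \<comment> \<open>\<open>G w\<close> contracts rows strictly, so it fixes none but zero.\<close>
    have iF: "invertible (F w)"
    proof (rule invertible_vector_matrix)
      fix r assume "r v* F w = 0"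
      hence "r v* G w = r" by (simp add: F_def vector_matrix_mult_diff_rdistrib)
      hence "norm r \<le> norm (cayley w) * norm r" using rG[of r] by simp
      hence "(1 - norm (cayley w)) * norm r \<le> 0" by (simp add: algebra_simps)
      thus "r = 0" using c1' by (simp add: mult_le_0_iff)
    qed
    define r where "r = (\<chi> i. cnj (v $ i)) v* matrix_inv (F w)"
    have "(norm v)\<^sup>2 \<le> norm r * norm (F w *v v)"
      unfolding r_def by (rule norm_squared_le_row[OF iF])
    also have "\<dots> \<le> norm r * (K' * \<epsilon>)"
      using elim by (intro mult_left_mono) (auto simp: u_def w_def)
    finally have "((norm v)\<^sup>2)\<^sup>2 \<le> (norm r * (K' * \<epsilon>))\<^sup>2" by (intro power_mono) auto
    hence v4: "(norm v)^4 \<le> (norm r)\<^sup>2 * K'\<^sup>2 * \<epsilon>\<^sup>2"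
      by (simp add: power_mult_distrib mult_ac flip: power_mult)
    have "(norm (w + \<i>))\<^sup>2 = s\<^sup>2 + (\<epsilon> + 1)\<^sup>2" by (simp add: w_def cmod_power2)
    also have "\<dots> \<le> s\<^sup>2 + 2\<^sup>2" using elim by (intro add_left_mono power_mono) auto
    finally have ws: "(norm (w + \<i>))\<^sup>2 \<le> s\<^sup>2 + 4" by simp
    have "k / \<epsilon> \<le> 4 * \<epsilon> / (s\<^sup>2 + 4) * (norm r)\<^sup>2"
    proof -
      have "k / \<epsilon> = 4 * \<epsilon> / (s\<^sup>2 + 4) * ((norm v)^4 / (K'\<^sup>2 * \<epsilon>\<^sup>2))"
        using elim by (simp add: k_def power2_eq_square)
      also have "\<dots> \<le> 4 * \<epsilon> / (s\<^sup>2 + 4) * (norm r)\<^sup>2"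
        using elim s4 K' v4 by (intro mult_left_mono) (auto simp: divide_simps mult_ac)
      finally show ?thesis .
    qed
    also have "\<dots> \<le> 4 * \<epsilon> / (norm (w + \<i>))\<^sup>2 * (norm r)\<^sup>2"
      using elim ws w0 s4 by (intro mult_right_mono divide_left_mono mult_pos_pos) auto
    also have "\<dots> = (1 - (norm (cayley w))\<^sup>2) * (norm r)\<^sup>2"
      using w by (simp add: one_minus_norm_cayley) (simp add: w_def)
    also have "\<dots> = (norm r)\<^sup>2 - (norm (cayley w) * norm r)\<^sup>2"
      by (simp add: power_mult_distrib algebra_simps)
    also have "\<dots> \<le> (norm r)\<^sup>2 - (norm (r v* G w))\<^sup>2"
      using rG[of r] by (intro diff_left_mono power_mono) auto
    also have "\<dots> = Re (qform (Re_mat (matrix_inv (mat 1 - G w) ** (mat 1 + G w))) v)"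
      using qform_Re_mat_cayley[of "G w" v] iF by (simp add: F_def r_def)
    finally show ?case by (simp add: G_def w_def)
  qed
  thus ?thesis by (rule spectral_measure_atom[OF assms(5) k])
qed

end
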